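(* Let $f=g+h$ where $g:\mathbb{R}^d\to\mathbb{R}$ is $\rho$-weakly convex ($\rho>0$) and $h$ is the indicator function of a nonempty closed convex set $\mathcal{X}\subseteq\mathbb{R}^d$. Suppose there are $c>0$ and $\theta\in[1/2,1]$ such that $\|\nabla f_{1/(2\rho)}(x)\|\ge c\,(f_{1/(2\rho)}(x)-f^* )^{\theta}$ for all $x\in V$. Let $x_0\in\mathcal{X}$, $\Delta_0=f_{1/(2\rho)}(x_0)-f^*>0$, $\gamma>0$ and $N\in\mathbb{N}$. For $k=0,\dots,N-1$, let $x_{k+1}$ be the output of the projected stochastic subgradient method started at $x_k$ and run for $$t_k=16c^{-4}\rho L^2\Delta_0^{1-4\theta}\exp(4\theta\gamma)\exp((4\theta-1)\gamma k)$$ iterations with constant step size $$\alpha=\frac{(f_{1/(2\rho)}(x_k)-f^* )^{1/2}}{\sqrt{\rho}\,L\sqrt{t_k+1}}.$$ Let $T=\sum_{k=0}^{N-1}t_k$ be the total number of inner iterations. Then $$\mathbb{E}[f_{1/(2\rho)}(x_N)]-f^*\le\frac{f_{1/(2\rho)}(x_0)-f^*}{\left(\gamma(4\theta-1)C^{-1}T+1\right)^{1/(4\theta-1)}},$$ where $C=16c^{-4}\rho L^2\Delta_0^{1-4\theta}\exp(4\theta\gamma)$.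
   Context: A function $g$ is $\rho$-weakly convex if $x\mapsto g(x)+\frac{\rho}{2}\|x\|^2$ is convex. $f^*=\inf_{\mathbb{R}^d} f$ is assumed finite. The Moreau envelope is $f_\lambda(x)=\min_y\{f(y)+\frac{1}{2\lambda}\|y-x\|^2\}$; for $0<\lambda<\rho^{-1}$ it is $C^1$, with $\nabla f_\lambda(x)=\lambda^{-1}(x-\operatorname{prox}_{\lambda f}(x))$ and $\operatorname{prox}_{\lambda f}(x)$ the minimizer in its definition. Here $\lambda=1/(2\rho)$. Stochastic oracle: $L>0$, and $G(x,\xi)$ is a random vector ($\xi$ random) with $\mathbb{E}_\xi[G(x,\xi)]\in\partial g(x)$ (Fréchet subdifferential) and $\mathbb{E}_\xi[\|G(x,\xi)\|^2]\le L^2$ for all $x\in\mathcal{X}$. Projected stochastic subgradient method started at $y_0$, with $n$ iterations and constant step size $\alpha$: for $s=0,\dots,n-1$, draw a fresh independent sample $\xi_s$ and set $y_{s+1}=\mathrm{proj}_{\mathcal{X}}(y_s-\alpha G(y_s,\xi_s))$; then draw $s^*$ uniformly from $\{0,\dots,n\}$, independently of everything else, and output $y_{s^*}$. In a restart scheme all samples and output indices are independent across inner and outer iterations. $V\subseteq\mathbb{R}^d$ is a set containing $x_0$ and, almost surely, all outer iterates $x_k$ (for instance $V=\mathbb{R}^d$). The numbers of iterations $t_k$ are taken to be integers. *)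

theory Defs
  imports "HOL-Probability.Probability"
begin

definition weakly_convex :: "real \<Rightarrow> ('a::euclidean_space \<Rightarrow> real) \<Rightarrow> bool" where
  "weakly_convex \<rho> g \<longleftrightarrow> convex_on UNIV (\<lambda>x. g x + \<rho> / 2 * (norm x)\<^sup>2)"

definition convex_indicator :: "'a set \<Rightarrow> 'a \<Rightarrow> ereal" where
  "convex_indicator X x = (if x \<in> X then 0 else \<infinity>)"

definition frechet_subdifferential :: "('a::euclidean_space \<Rightarrow> real) \<Rightarrow> 'a \<Rightarrow> 'a set" where
  "frechet_subdifferential g x =
     {v. 0 \<le> Liminf (at x) (\<lambda>y. ereal ((g y - g x - v \<bullet> (y - x)) / norm (y - x)))}"

definition moreau_envelope :: "real \<Rightarrow> ('a::euclidean_space \<Rightarrow> ereal) \<Rightarrow> 'a \<Rightarrow> ereal" where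
  "moreau_envelope lam f x = (INF y. f y + ereal ((norm (y - x))\<^sup>2 / (2 * lam)))"

(* Only meaningful where the gradient exists. *)
definition gradient :: "('a::euclidean_space \<Rightarrow> real) \<Rightarrow> 'a \<Rightarrow> 'a" where
  "gradient \<phi> x = (THE D. GDERIV \<phi> x :> D)"

(* Joint measurability in (x, z) is what makes the iterates of the method random variables;
   it is only required on X, where the oracle is queried. *)
definition stochastic_oracle ::
  "('a::euclidean_space \<Rightarrow> real) \<Rightarrow> 'a set \<Rightarrow> real \<Rightarrow> 'b measure \<Rightarrow> ('a \<Rightarrow> 'b \<Rightarrow> 'a) \<Rightarrow> bool" where
  "stochastic_oracle g X L D G \<longleftrightarrow>
     prob_space D \<and>
     (\<lambda>(x, z). G x z) \<in> borel_measurable (restrict_space borel X \<Otimes>\<^sub>M D) \<and>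
     (\<forall>x\<in>X. integrable D (G x) \<and>
            (\<integral>z. G x z \<partial>D) \<in> frechet_subdifferential g x \<and>
            integrable D (\<lambda>z. (norm (G x z))\<^sup>2) \<and>
            (\<integral>z. (norm (G x z))\<^sup>2 \<partial>D) \<le> L\<^sup>2)"

primrec psgm_iterate ::
  "'a::euclidean_space set \<Rightarrow> ('a \<Rightarrow> 'b \<Rightarrow> 'a) \<Rightarrow> real \<Rightarrow> 'a \<Rightarrow> (nat \<Rightarrow> 'b) \<Rightarrow> nat \<Rightarrow> 'a" where
  "psgm_iterate X G \<alpha> y z 0 = y"
| "psgm_iterate X G \<alpha> y z (Suc s) =
     closest_point X (psgm_iterate X G \<alpha> y z s - \<alpha> *\<^sub>R G (psgm_iterate X G \<alpha> y z s) (z s))"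

(* The random inputs of N outer iterations, the k-th of length t k: samples \<xi> k s with law D
   and output indices S k uniform on {0..t k}, all mutually independent. The samples and the
   indices have different types, so independence is stated for the sigma-algebras they generate
   (which is how indep_vars is defined). *)
definition independent_restart_inputs ::
  "'w measure \<Rightarrow> 'b measure \<Rightarrow> nat \<Rightarrow> (nat \<Rightarrow> nat) \<Rightarrow> (nat \<Rightarrow> nat \<Rightarrow> 'w \<Rightarrow> 'b) \<Rightarrow> (nat \<Rightarrow> 'w \<Rightarrow> nat) \<Rightarrow> bool"
where
  "independent_restart_inputs M D N t \<xi> S \<longleftrightarrow>
     prob_space M \<and>
     (\<forall>k<N. \<forall>s<t k. \<xi> k s \<in> measurable M D \<and> distr M D (\<xi> k s) = D) \<and>
     (\<forall>k<N. S k \<in> measurable M (count_space {0..t k}) \<and>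
            distr M (count_space {0..t k}) (S k) = uniform_count_measure {0..t k}) \<and>
     prob_space.indep_sets M
       (case_sum (\<lambda>(k, s). {\<xi> k s -` A \<inter> space M | A. A \<in> sets D})
                 (\<lambda>k. {S k -` A \<inter> space M | A. A \<in> sets (count_space {0..t k})}))
       (Inl ` {(k, s). k < N \<and> s < t k} \<union> Inr ` {k. k < N})"

end

theory Submission
  imports Defs
begin

text \<open>Write \<open>\<Delta>\<^sub>k\<close> for the envelope gap at the \<open>k\<close>-th outer iterate. A projected step is compared with
  the proximal point of the current iterate; weak convexity then gives the descent inequality
  \<open>E \<phi>(y\<^sub>s\<^sub>+\<^sub>1) \<le> \<phi>(y\<^sub>s) - \<alpha>/2 \<parallel>\<nabla>\<phi>(y\<^sub>s)\<parallel>\<^sup>2 + \<rho>\<alpha>\<^sup>2L\<^sup>2\<close>. Dividing by \<open>\<alpha>\<close>, summing over the inner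
  iterations and averaging over the output index bounds \<open>E \<parallel>\<nabla>\<phi>(x\<^sub>k\<^sub>+\<^sub>1)\<parallel>\<^sup>2\<close> by a multiple of
  \<open>E \<Delta>\<^sub>k\<^sup>1\<^sup>/\<^sup>2 / (t\<^sub>k + 1)\<^sup>1\<^sup>/\<^sup>2\<close>. By the gradient inequality and Jensen (both for the square root and for
  the power \<open>2\<theta> \<ge> 1\<close>), the choice of \<open>t\<^sub>k\<close> yields \<open>E \<Delta>\<^sub>k \<le> \<Delta>\<^sub>0 exp(-\<gamma>k)\<close> by induction, and \<open>T\<close> is
  a geometric sum with ratio \<open>exp((4\<theta>-1)\<gamma>)\<close>. All expectations are taken as extended nonnegative
  integrals, so that no integrability has to be carried through the induction.\<close>

section \<open>Weakly convex functions and the Moreau envelope\<close>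

lemma weakly_convex_combination:
  fixes x y :: "'a::euclidean_space"
  assumes "weakly_convex \<rho> g" "0 \<le> t" "t \<le> 1"
  shows "g (x + t *\<^sub>R (y - x)) \<le> (1 - t) * g x + t * g y + \<rho> / 2 * t * (1 - t) * (norm (y - x))\<^sup>2"
proof -
  have eq: "x + t *\<^sub>R (y - x) = (1 - t) *\<^sub>R x + t *\<^sub>R y"
    by (simp add: algebra_simps)
  have "g ((1 - t) *\<^sub>R x + t *\<^sub>R y) + \<rho> / 2 * (norm ((1 - t) *\<^sub>R x + t *\<^sub>R y))\<^sup>2
      \<le> (1 - t) * (g x + \<rho> / 2 * (norm x)\<^sup>2) + t * (g y + \<rho> / 2 * (norm y)\<^sup>2)"
    using convex_onD[OF assms(1)[unfolded weakly_convex_def], of t x y] assms by simp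
  moreover have "(norm ((1 - t) *\<^sub>R x + t *\<^sub>R y))\<^sup>2
      = (1 - t) * (norm x)\<^sup>2 + t * (norm y)\<^sup>2 - t * (1 - t) * (norm (y - x))\<^sup>2"
    unfolding power2_norm_eq_inner by (simp add: inner_simps inner_commute) algebra
  ultimately have "g ((1 - t) *\<^sub>R x + t *\<^sub>R y)
        + \<rho> / 2 * ((1 - t) * (norm x)\<^sup>2 + t * (norm y)\<^sup>2 - t * (1 - t) * (norm (y - x))\<^sup>2)
      \<le> (1 - t) * (g x + \<rho> / 2 * (norm x)\<^sup>2) + t * (g y + \<rho> / 2 * (norm y)\<^sup>2)"
    by simp
  then show ?thesis
    unfolding eq by (simp add: algebra_simps diff_divide_distrib)
qed

lemma weakly_convex_continuous_on:
  fixes g :: "'a::euclidean_space \<Rightarrow> real"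
  assumes "weakly_convex \<rho> g"
  shows "continuous_on S g"
proof -
  have "continuous_on UNIV (\<lambda>x. (g x + \<rho> / 2 * (norm x)\<^sup>2) - \<rho> / 2 * (norm x)\<^sup>2)"
    using assms unfolding weakly_convex_def
    by (intro continuous_intros convex_on_continuous) auto
  then show ?thesis
    by (auto intro: continuous_on_subset)
qed

text \<open>Letting \<open>t\<close> tend to 0 removes the last term. This elementary limit serves
  every segment argument below.\<close>

lemma le_of_le_add_small_multiple:
  fixes a b c :: real
  assumes "\<And>t. 0 < t \<Longrightarrow> t \<le> 1 \<Longrightarrow> a \<le> b + t * c"
  shows "a \<le> b"
proof (rule field_le_epsilon)
  fix e :: real assume "e > 0"
  define t where "t = min 1 (e / (\<bar>c\<bar> + 1))"
  have t: "0 < t" "t \<le> 1"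
    using \<open>e > 0\<close> by (auto simp: t_def)
  have "t \<le> e / (\<bar>c\<bar> + 1)" by (simp add: t_def)
  then have "t * (\<bar>c\<bar> + 1) \<le> e" by (simp add: pos_le_divide_eq)
  have "t * c \<le> t * (\<bar>c\<bar> + 1)" using t by (intro mult_left_mono) auto
  then show "a \<le> b + e" using assms[OF t] \<open>t * (\<bar>c\<bar> + 1) \<le> e\<close> by linarith
qed

text \<open>The Liminf condition is local, but weak convexity makes it global: near \<open>x\<close>
  on the segment to \<open>y\<close>, the subgradient condition bounds \<open>g\<close> below and
  the chord bounds it above. Dividing by \<open>t\<close> and letting first \<open>t\<close>, then
  the slack \<open>e\<close>, tend to 0 gives the claim.\<close>

lemma weakly_convex_subgradient:
  fixes g :: "'a::euclidean_space \<Rightarrow> real"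
  assumes wc: "weakly_convex \<rho> g" and v: "v \<in> frechet_subdifferential g x"
  shows "g x + v \<bullet> (y - x) - \<rho> / 2 * (norm (y - x))\<^sup>2 \<le> g y"
proof (cases "y = x")
  case False
  define r where "r = norm (y - x)"
  have r: "r > 0" using False by (simp add: r_def)
  have "v \<bullet> (y - x) \<le> g y - g x + \<rho> / 2 * r\<^sup>2 + e * r" if e: "e > 0" for e
  proof -
    have "ereal (- e) < Liminf (at x) (\<lambda>y. ereal ((g y - g x - v \<bullet> (y - x)) / norm (y - x)))"
      using v e unfolding frechet_subdifferential_def by (auto intro: less_le_trans[of _ 0])
    from less_LiminfD[OF this] obtain d where d: "d > 0"
      and quot: "\<And>z. z \<noteq> x \<Longrightarrow> dist z x < d \<Longrightarrow> - e < (g z - g x - v \<bullet> (z - x)) / norm (z - x)"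
      unfolding eventually_at by auto
    \<comment> \<open>For \<open>t \<le> t0\<close> the point \<open>x + t *\<^sub>R (y - x)\<close>
      stays on the segment and within distance \<open>d\<close> of \<open>x\<close>.\<close>
    define t0 where "t0 = min 1 (d / (2 * r))"
    have t0: "0 < t0" "t0 \<le> 1" "t0 * r < d"
      using d r by (auto simp: t0_def min_def field_simps)
    have bound: "v \<bullet> (y - x) \<le> g y - g x + \<rho> / 2 * r\<^sup>2 + e * r + t * (- \<rho> / 2 * r\<^sup>2)"
      if t: "0 < t" "t \<le> t0" for t
    proof -
      let ?z = "x + t *\<^sub>R (y - x)"
      have nz: "norm (?z - x) = t * r" using t by (simp add: r_def)
      have "t * r \<le> t0 * r" using t r by simp
      then have "- e < (g ?z - g x - v \<bullet> (?z - x)) / norm (?z - x)"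
        using False t t0 nz by (intro quot) (auto simp: dist_norm)
      then have "- e < (g ?z - g x - v \<bullet> (?z - x)) / (t * r)"
        unfolding nz .
      then have "- e * (t * r) < g ?z - g x - t * (v \<bullet> (y - x))"
        using t r by (simp add: pos_less_divide_eq)
      moreover have "g ?z \<le> (1 - t) * g x + t * g y + \<rho> / 2 * t * (1 - t) * r\<^sup>2"
        unfolding r_def using t t0 by (intro weakly_convex_combination[OF wc]) auto
      ultimately have "t * (v \<bullet> (y - x))
          \<le> t * (g y - g x + \<rho> / 2 * r\<^sup>2 + e * r + t * (- \<rho> / 2 * r\<^sup>2))"
        by (simp add: algebra_simps diff_divide_distrib)
      then show ?thesis using t by simp
    qed
    show ?thesis
    \<comment> \<open>Only parameters up to \<open>t0\<close> are admissible, so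
      \<open>bound\<close> is used at \<open>t * t0\<close> and \<open>t0\<close> is absorbed into
      the coefficient.\<close>
    proof (rule le_of_le_add_small_multiple)
      fix t :: real assume t: "0 < t" "t \<le> 1"
      have "0 < t * t0" "t * t0 \<le> t0" using t t0 by (auto simp: mult_left_le_one_le)
      from bound[OF this]
      show "v \<bullet> (y - x) \<le> g y - g x + \<rho> / 2 * r\<^sup>2 + e * r + t * (t0 * (- \<rho> / 2 * r\<^sup>2))"
        by (simp add: algebra_simps)
    qed
  qed
  then have "v \<bullet> (y - x) \<le> (g y - g x + \<rho> / 2 * r\<^sup>2) + e * r" if "0 < e" "e \<le> 1" for e
    using that by (simp add: mult.commute)
  from le_of_le_add_small_multiple[OF this] show ?thesis
    by (simp add: r_def)
qed auto

text \<open>Derivatives are unique, so the description in \<open>gradient\<close> is well defined;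
  testing the two linear maps on \<open>E - D\<close> identifies the vectors.\<close>

lemma gradient_eq:
  assumes "GDERIV \<phi> x :> D"
  shows "gradient \<phi> x = D"
  unfolding gradient_def
proof (rule the_equality)
  fix E assume "GDERIV \<phi> x :> E"
  with assms have "(\<lambda>h. h \<bullet> E) = (\<lambda>h. h \<bullet> D)"
    unfolding gderiv_def by (rule has_derivative_unique[rotated])
  then have "(E - D) \<bullet> (E - D) = 0"
    by (metis (no_types) inner_diff_right right_minus_eq)
  then show "E = D" by simp
qed fact

section \<open>The proximal map and the envelope on a closed convex set\<close>

locale weakly_convex_on_set =
  fixes g :: "'a::euclidean_space \<Rightarrow> real" and X :: "'a set" and \<rho> m :: real
  assumes rho_pos: "\<rho> > 0"
    and weakly_convex: "weakly_convex \<rho> g"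
    and X_closed: "closed X" and X_convex: "convex X" and X_nonempty: "X \<noteq> {}"
    and lower_bound: "\<And>y. y \<in> X \<Longrightarrow> m \<le> g y"
begin

text \<open>The coefficient \<rho> is 1/(2 lam) for lam = 1/(2\<rho>). Minimizing over
  \<open>X\<close> replaces adding the indicator, which keeps all values real.\<close>

definition prox :: "'a \<Rightarrow> 'a" where
  "prox x = (SOME p. p \<in> X \<and> (\<forall>z\<in>X. g p + \<rho> * (norm (p - x))\<^sup>2 \<le> g z + \<rho> * (norm (z - x))\<^sup>2))"

definition env :: "'a \<Rightarrow> real" where
  "env x = g (prox x) + \<rho> * (norm (prox x - x))\<^sup>2"

definition grad :: "'a \<Rightarrow> 'a" where
  "grad x = (2 * \<rho>) *\<^sub>R (x - prox x)"

text \<open>Since \<open>g\<close> is bounded below on \<open>X\<close>, the proximal objective is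
  coercive there, and a minimum over a compact piece of \<open>X\<close> is global.\<close>

lemma prox_exists: "\<exists>p. p \<in> X \<and> (\<forall>z\<in>X. g p + \<rho> * (norm (p - x))\<^sup>2 \<le> g z + \<rho> * (norm (z - x))\<^sup>2)"
proof -
  obtain y where y: "y \<in> X" using X_nonempty by auto
  define q where "q z = g z + \<rho> * (norm (z - x))\<^sup>2" for z
  \<comment> \<open>Chosen so that \<open>m + \<rho> * R\<close> exceeds \<open>q y\<close>; as
    \<open>R \<ge> 1\<close>, beyond distance \<open>R\<close> the squared distance is at least
    \<open>R\<close>.\<close>
  define R where "R = (q y - m) / \<rho> + 1"
  have qy: "m + \<rho> * (norm (y - x))\<^sup>2 \<le> q y" using lower_bound[OF y] by (simp add: q_def)
  have "0 \<le> \<rho> * (norm (y - x))\<^sup>2" using rho_pos by simp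
  with qy have "0 \<le> (q y - m) / \<rho>" using rho_pos by (intro divide_nonneg_pos) linarith+
  then have R: "R \<ge> 1" by (simp add: R_def)
  have far: "q y \<le> q z" if "z \<in> X" "z \<notin> cball x R" for z
  proof -
    have "R \<le> norm (z - x)" using that by (simp add: dist_norm norm_minus_commute)
    moreover have "norm (z - x) \<le> (norm (z - x))\<^sup>2"
      using calculation R by (intro self_le_power) auto
    ultimately have "\<rho> * R \<le> \<rho> * (norm (z - x))\<^sup>2" using rho_pos by simp
    moreover have "\<rho> * R = q y - m + \<rho>" using rho_pos by (simp add: R_def field_simps)
    ultimately show ?thesis using lower_bound[OF that(1)] rho_pos unfolding q_def[of z] by linarith
  qed
  have "norm (y - x) \<le> R"
  proof (cases "norm (y - x) \<le> 1")
    case False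
    then have "norm (y - x) \<le> (norm (y - x))\<^sup>2" by (intro self_le_power) auto
    also have "\<dots> \<le> (q y - m) / \<rho>" using qy rho_pos by (simp add: field_simps)
    finally show ?thesis by (simp add: R_def)
  qed (use R in linarith)
  then have yin: "y \<in> X \<inter> cball x R" using y by (simp add: dist_norm norm_minus_commute)
  have "compact (X \<inter> cball x R)" using X_closed by (simp add: closed_Int_compact)
  moreover have "continuous_on (X \<inter> cball x R) q"
    unfolding q_def by (intro continuous_intros weakly_convex_continuous_on[OF weakly_convex])
  ultimately obtain p where p: "p \<in> X \<inter> cball x R" "\<forall>z\<in>X \<inter> cball x R. q p \<le> q z"
    using continuous_attains_inf[of "X \<inter> cball x R" q] yin by blast
  have "q p \<le> q z" if "z \<in> X" for z
    using p yin far[OF that] that by (cases "z \<in> cball x R") (auto intro: order_trans)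
  then show ?thesis using p unfolding q_def by blast
qed

lemma prox_in: "prox x \<in> X"
  and env_le: "z \<in> X \<Longrightarrow> env x \<le> g z + \<rho> * (norm (z - x))\<^sup>2"
  using someI_ex[OF prox_exists[of x]] unfolding env_def prox_def[symmetric] by blast+

lemma env_lower_bound: "m + \<rho> * (norm (prox x - x))\<^sup>2 \<le> env x"
  using lower_bound[OF prox_in] by (simp add: env_def)

lemma env_ge: "m \<le> env x"
  using env_lower_bound[of x] rho_pos by (smt (verit) mult_nonneg_nonneg zero_le_power2)

text \<open>At gap zero the lower bound forces \<open>prox x = x\<close>. This settles the
  degenerate case of a zero step size.\<close>

lemma grad_eq_0: "env x = m \<Longrightarrow> grad x = 0"
  using env_lower_bound[of x] rho_pos by (simp add: grad_def mult_le_0_iff)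

text \<open>The term \<rho> norm^2 is 2\<rho>-strongly convex and \<open>g\<close> loses at most
  \<rho>, so the proximal objective is \<rho>-strongly convex and grows quadratically around its
  minimizer. The proof compares with a point on the segment to \<open>z\<close> and lets it approach
  \<open>prox x\<close>.\<close>

lemma env_add_quadratic_le:
  assumes z: "z \<in> X"
  shows "env x + \<rho> / 2 * (norm (z - prox x))\<^sup>2 \<le> g z + \<rho> * (norm (z - x))\<^sup>2"
proof -
  define d where "d = \<rho> / 2 * (norm (z - prox x))\<^sup>2"
  define q where "q = g z + \<rho> * (norm (z - x))\<^sup>2"
  have "env x + d \<le> q"
  proof (rule le_of_le_add_small_multiple)
    fix t :: real assume t: "0 < t" "t \<le> 1"
    let ?w = "prox x + t *\<^sub>R (z - prox x)"
    have "?w = (1 - t) *\<^sub>R prox x + t *\<^sub>R z" by (simp add: algebra_simps)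
    then have "?w \<in> X" using X_convex z prox_in[of x] t by (simp add: convex_def)
    then have "env x \<le> g ?w + \<rho> * (norm (?w - x))\<^sup>2" by (rule env_le)
    moreover have "g ?w \<le> (1 - t) * g (prox x) + t * g z + t * (1 - t) * d"
      using weakly_convex_combination[OF weakly_convex, of t "prox x" z] t
      by (simp add: d_def mult_ac)
    moreover have "(norm (?w - x))\<^sup>2
        = (1 - t) * (norm (prox x - x))\<^sup>2 + t * (norm (z - x))\<^sup>2 - t * (1 - t) * (norm (z - prox x))\<^sup>2"
      unfolding power2_norm_eq_inner by (simp add: inner_simps inner_commute) algebra
    ultimately have "env x \<le> (1 - t) * g (prox x) + t * g z + t * (1 - t) * d
        + \<rho> * ((1 - t) * (norm (prox x - x))\<^sup>2 + t * (norm (z - x))\<^sup>2 - t * (1 - t) * (norm (z - prox x))\<^sup>2)"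
      by simp
    \<comment> \<open>Weak convexity costs one multiple of \<open>d\<close> and the proximal term
      gains two.\<close>
    also have "\<dots> = (1 - t) * env x + t * q - t * (1 - t) * d"
      by (simp add: env_def q_def d_def algebra_simps)
    finally have "t * (env x + d) \<le> t * (q + t * d)" by (simp add: algebra_simps)
    then show "env x + d \<le> q + t * d" using t by simp
  qed
  then show ?thesis by (simp add: d_def q_def)
qed

text \<open>The quadratic growth of the proximal objective at \<^term>\<open>prox x\<close>, evaluated at \<^term>\<open>prox y\<close>,
  gives both the lower expansion of the envelope and the Lipschitz bound for the proximal map.\<close>

lemma env_ge_expansion:
  "env x + grad x \<bullet> (y - x) + \<rho> * (norm (y - x))\<^sup>2 + \<rho> / 2 * (norm (prox y - prox x))\<^sup>2
    - 2 * \<rho> * ((y - x) \<bullet> (prox y - prox x)) \<le> env y"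
proof -
  have "\<rho> * ((norm (prox y - y))\<^sup>2 - (norm (prox y - x))\<^sup>2)
      = grad x \<bullet> (y - x) + \<rho> * (norm (y - x))\<^sup>2 - 2 * \<rho> * ((y - x) \<bullet> (prox y - prox x))"
    unfolding power2_norm_eq_inner grad_def by (simp add: inner_simps inner_commute algebra_simps)
  with env_add_quadratic_le[OF prox_in, of x y] show ?thesis
    unfolding env_def[of y] by (simp add: algebra_simps)
qed

text \<open>The point \<open>prox x\<close> is a competitor in the minimization defining
  \<open>env y\<close>.\<close>

lemma env_le_expansion: "env y \<le> env x + grad x \<bullet> (y - x) + \<rho> * (norm (y - x))\<^sup>2"
proof -
  have "\<rho> * ((norm (prox x - y))\<^sup>2 - (norm (prox x - x))\<^sup>2) = grad x \<bullet> (y - x) + \<rho> * (norm (y - x))\<^sup>2"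
    unfolding power2_norm_eq_inner grad_def by (simp add: inner_simps inner_commute algebra_simps)
  with env_le[OF prox_in, of y x] show ?thesis
    unfolding env_def[of x] by (simp add: algebra_simps)
qed

lemma prox_lipschitz: "norm (prox y - prox x) \<le> 4 * norm (y - x)"
proof -
  let ?d = "norm (prox y - prox x)" and ?h = "norm (y - x)"
  \<comment> \<open>Both expansions share the terms of first and second order in
    \<open>y - x\<close>; these cancel.\<close>
  have "\<rho> / 2 * ?d\<^sup>2 \<le> 2 * \<rho> * ((y - x) \<bullet> (prox y - prox x))"
    using env_ge_expansion[of x y] env_le_expansion[of y x] by linarith
  also have "\<dots> \<le> 2 * \<rho> * (?h * ?d)"
    using rho_pos by (simp add: norm_cauchy_schwarz)
  finally have "?d * ?d \<le> (4 * ?h) * ?d"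
    using rho_pos by (simp add: power2_eq_square field_simps)
  then show ?thesis by (cases "?d = 0") auto
qed

lemma abs_env_expansion: "\<bar>env y - env x - grad x \<bullet> (y - x)\<bar> \<le> \<rho> * (norm (y - x))\<^sup>2"
proof -
  let ?d = "prox y - prox x" and ?h = "y - x"
  \<comment> \<open>Completing the square in the displacement of the proximal point turns the lower
    expansion into an error of at least \<open>- \<rho> * (norm ?h)\<^sup>2\<close>.\<close>
  have "0 \<le> \<rho> / 2 * (norm (2 *\<^sub>R ?h - ?d))\<^sup>2" using rho_pos by simp
  also have "\<dots> = 2 * \<rho> * (norm ?h)\<^sup>2 + \<rho> / 2 * (norm ?d)\<^sup>2 - 2 * \<rho> * (?h \<bullet> ?d)"
    unfolding power2_norm_eq_inner by (simp add: inner_simps inner_commute algebra_simps)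
  finally show ?thesis
    using env_ge_expansion[of x y] env_le_expansion[of y x] by linarith
qed

lemma gderiv_env: "GDERIV env x :> grad x"
  unfolding gderiv_def has_derivative_within_alt
proof (intro conjI allI impI)
  show "bounded_linear (\<lambda>h. h \<bullet> grad x)" by (rule bounded_linear_inner_left)
  fix e :: real assume e: "e > 0"
  show "\<exists>d>0. \<forall>y\<in>UNIV. norm (y - x) < d \<longrightarrow>
      norm (env y - env x - (y - x) \<bullet> grad x) \<le> e * norm (y - x)"
  proof (intro exI[of _ "e / \<rho>"] conjI ballI impI)
    fix y assume "norm (y - x) < e / \<rho>"
    then have "\<rho> * norm (y - x) \<le> e" using rho_pos by (simp add: field_simps)
    then have "\<rho> * (norm (y - x))\<^sup>2 \<le> e * norm (y - x)"
      unfolding power2_eq_square mult.assoc[symmetric] by (intro mult_right_mono) auto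
    with abs_env_expansion[of y x]
    show "norm (env y - env x - (y - x) \<bullet> grad x) \<le> e * norm (y - x)"
      by (simp add: inner_commute)
  qed (use e rho_pos in simp)
qed

lemma continuous_on_env: "continuous_on S env"
  using gderiv_env unfolding gderiv_def
  by (meson continuous_at_imp_continuous_on has_derivative_continuous)

lemma continuous_on_grad: "continuous_on S grad"
proof -
  have "4-lipschitz_on UNIV prox"
    by (rule lipschitz_onI) (simp_all add: dist_norm prox_lipschitz)
  then have "continuous_on S prox"
    by (auto intro: lipschitz_on_continuous_on continuous_on_subset)
  then show ?thesis unfolding grad_def by (intro continuous_intros)
qed

lemma moreau_envelope_eq:
  "moreau_envelope (1 / (2 * \<rho>)) (\<lambda>y. ereal (g y) + convex_indicator X y) x = ereal (env x)"
  unfolding moreau_envelope_def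
proof (rule INF_eqI)
  fix y
  show "ereal (env x) \<le> ereal (g y) + convex_indicator X y + ereal ((norm (y - x))\<^sup>2 / (2 * (1 / (2 * \<rho>))))"
    using env_le[of y x] by (simp add: convex_indicator_def field_simps)
next
  fix e :: ereal
  assume "\<And>y. y \<in> UNIV \<Longrightarrow>
    e \<le> ereal (g y) + convex_indicator X y + ereal ((norm (y - x))\<^sup>2 / (2 * (1 / (2 * \<rho>))))"
  from this[of "prox x"] show "e \<le> ereal (env x)"
    using prox_in[of x] by (simp add: convex_indicator_def env_def field_simps)
qed

text \<open>Quadratic growth at \<open>z = x\<close> puts \<open>g (prox x)\<close> below
  \<open>g x\<close> by 3\<rho>/2 times the squared distance; the subgradient inequality at
  \<open>prox x\<close> gives back only \<rho>/2 of it.\<close>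

lemma inner_subgradient_prox_le:
  assumes x: "x \<in> X" and v: "v \<in> frechet_subdifferential g x"
  shows "v \<bullet> (prox x - x) \<le> - \<rho> * (norm (prox x - x))\<^sup>2"
  using weakly_convex_subgradient[OF weakly_convex v, of "prox x"] env_add_quadratic_le[OF x, of x]
  by (simp add: env_def norm_minus_commute)

end

section \<open>Descent of the projected stochastic subgradient method\<close>

text \<open>Independence makes the joint law of \<open>Y\<close> and \<open>Z\<close> a product, and
  Tonelli integrates out \<open>Z\<close> first. This takes the place of conditioning on the past
  \<open>F\<close>.\<close>

lemma (in prob_space) nn_integral_indep_pair:
  assumes F: "subalgebra M F" and Y: "Y \<in> measurable F K" and Z: "Z \<in> measurable M D"
    and indep: "indep_set (sets F) {Z -` A \<inter> space M | A. A \<in> sets D}"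
    and h: "h \<in> borel_measurable (K \<Otimes>\<^sub>M D)"
  shows "(\<integral>\<^sup>+\<omega>. h (Y \<omega>, Z \<omega>) \<partial>M) = (\<integral>\<^sup>+\<omega>. \<integral>\<^sup>+z. h (Y \<omega>, z) \<partial>distr M D Z \<partial>M)"
proof -
  have YM: "Y \<in> measurable M K" using F Y by (rule measurable_from_subalg)
  interpret Z: prob_space "distr M D Z" using Z by (rule prob_space_distr)
  interpret Y: prob_space "distr M K Y" using YM by (rule prob_space_distr)
  have pair [measurable]: "(\<lambda>\<omega>. (Y \<omega>, Z \<omega>)) \<in> measurable M (K \<Otimes>\<^sub>M D)"
    using YM Z by simp
  have law: "distr M K Y \<Otimes>\<^sub>M distr M D Z = distr M (K \<Otimes>\<^sub>M D) (\<lambda>\<omega>. (Y \<omega>, Z \<omega>))"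
  proof (rule pair_measure_eqI)
    fix A B assume "A \<in> sets (distr M K Y)" "B \<in> sets (distr M D Z)"
    then have A: "A \<in> sets K" and B: "B \<in> sets D" by simp_all
    have "Y -` A \<inter> space M \<in> sets F"
      using measurable_sets[OF Y A] F by (simp add: subalgebra_def)
    with indep B have "prob ((Y -` A \<inter> space M) \<inter> (Z -` B \<inter> space M))
        = prob (Y -` A \<inter> space M) * prob (Z -` B \<inter> space M)"
      by (intro indep_setD) auto
    moreover have "(\<lambda>\<omega>. (Y \<omega>, Z \<omega>)) -` (A \<times> B) \<inter> space M = (Y -` A \<inter> space M) \<inter> (Z -` B \<inter> space M)"
      by auto
    ultimately show "emeasure (distr M K Y) A * emeasure (distr M D Z) B
        = emeasure (distr M (K \<Otimes>\<^sub>M D) (\<lambda>\<omega>. (Y \<omega>, Z \<omega>))) (A \<times> B)"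
      using A B YM Z by (simp add: emeasure_distr emeasure_eq_measure ennreal_mult')
  qed (simp_all add: Y.sigma_finite_measure_axioms Z.sigma_finite_measure_axioms cong: sets_pair_measure_cong)
  have h': "h \<in> borel_measurable (K \<Otimes>\<^sub>M distr M D Z)"
    using h by (subst measurable_cong_sets[OF sets_pair_measure_cong[OF refl sets_distr] refl])
  have "(\<integral>\<^sup>+\<omega>. h (Y \<omega>, Z \<omega>) \<partial>M) = integral\<^sup>N (distr M K Y \<Otimes>\<^sub>M distr M D Z) h"
    unfolding law using YM Z h by (subst nn_integral_distr) auto
  also have "\<dots> = (\<integral>\<^sup>+u. \<integral>\<^sup>+z. h (u, z) \<partial>distr M D Z \<partial>distr M K Y)"
    using h' by (subst Z.nn_integral_fst) auto
  also have "\<dots> = (\<integral>\<^sup>+\<omega>. \<integral>\<^sup>+z. h (Y \<omega>, z) \<partial>distr M D Z \<partial>M)"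
    using YM h' by (intro nn_integral_distr Z.borel_measurable_nn_integral) auto
  finally show ?thesis .
qed

section \<open>A single projected stochastic step\<close>

locale subgradient_method = weakly_convex_on_set g X \<rho> m
  for g :: "'a::euclidean_space \<Rightarrow> real" and X :: "'a set" and \<rho> m :: real +
  fixes L :: real and D :: "'b measure" and G :: "'a \<Rightarrow> 'b \<Rightarrow> 'a"
  assumes L_pos: "L > 0" and unbiased: "stochastic_oracle g X L D G"
begin

abbreviation borel_X :: "'a measure" where
  "borel_X \<equiv> restrict_space borel X"

definition step :: "real \<Rightarrow> 'a \<Rightarrow> 'b \<Rightarrow> 'a" where
  "step a y z = closest_point X (y - a *\<^sub>R G y z)"

lemma measurable_env [measurable]: "env \<in> borel_measurable borel_X"
  and measurable_grad [measurable]: "grad \<in> borel_measurable borel_X"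
  by (intro measurable_restrict_space1 borel_measurable_continuous_onI continuous_on_env continuous_on_grad)+

lemma step_in: "step a y z \<in> X"
  unfolding step_def using X_closed X_nonempty by (rule closest_point_in_set)

text \<open>Step size and iterate are both random, hence joint measurability. The oracle is
  measurable only over \<open>X\<close>, so the values are placed in \<open>borel_X\<close>, from
  which the next step can start.\<close>

lemma measurable_step [measurable]:
  "(\<lambda>((a, y), z). step a y z) \<in> measurable ((borel \<Otimes>\<^sub>M borel_X) \<Otimes>\<^sub>M D) borel_X"
proof (rule measurable_restrict_space2)
  have [measurable]: "(\<lambda>(y, z). G y z) \<in> borel_measurable (borel_X \<Otimes>\<^sub>M D)"
    using unbiased by (simp add: stochastic_oracle_def)
  have "(\<lambda>p. (snd (fst p), snd p)) \<in> measurable ((borel \<Otimes>\<^sub>M borel_X) \<Otimes>\<^sub>M D) (borel_X \<Otimes>\<^sub>M D)"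
    by measurable
  from measurable_compose[OF this \<open>(\<lambda>(y, z). G y z) \<in> _\<close>]
  have [measurable]: "(\<lambda>p. G (snd (fst p)) (snd p)) \<in> borel_measurable ((borel \<Otimes>\<^sub>M borel_X) \<Otimes>\<^sub>M D)"
    by simp
  have [measurable]: "closest_point X \<in> borel_measurable borel"
    by (intro borel_measurable_continuous_onI continuous_on_closest_point X_convex X_closed X_nonempty)
  have [measurable]: "(\<lambda>x. x) \<in> borel_measurable borel_X"
    by (simp add: measurable_restrict_space1)
  have [measurable]: "(\<lambda>p. snd (fst p)) \<in> borel_measurable ((borel \<Otimes>\<^sub>M borel_X) \<Otimes>\<^sub>M D)"
    by (rule measurable_compose[of _ _ borel_X]) measurable
  show "(\<lambda>((a, y), z). step a y z) \<in> borel_measurable ((borel \<Otimes>\<^sub>M borel_X) \<Otimes>\<^sub>M D)"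
    unfolding step_def case_prod_beta by measurable
qed (auto simp: step_in)

text \<open>The point \<open>prox y\<close> competes in the envelope at the new iterate. Projection
  is nonexpansive and fixes \<open>prox y\<close>, so the distance is bounded by the one before
  projection, whose square is expanded.\<close>

lemma env_step_le:
  assumes y: "y \<in> X"
  shows "env (step a y z) \<le> env y + 2 * \<rho> * a * (G y z \<bullet> (prox y - y)) + \<rho> * a\<^sup>2 * (norm (G y z))\<^sup>2"
proof -
  have "closest_point X (prox y) = prox y" using prox_in by (rule closest_point_self)
  then have "norm (prox y - step a y z) \<le> norm (prox y - (y - a *\<^sub>R G y z))"
    using closest_point_lipschitz[OF X_convex X_closed X_nonempty, of "prox y" "y - a *\<^sub>R G y z"]
    by (simp add: step_def dist_norm)
  then have "(norm (prox y - step a y z))\<^sup>2 \<le> (norm (prox y - (y - a *\<^sub>R G y z)))\<^sup>2"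
    by (rule power_mono) simp
  also have "\<dots> = (norm (prox y - y))\<^sup>2 + 2 * a * (G y z \<bullet> (prox y - y)) + a\<^sup>2 * (norm (G y z))\<^sup>2"
    unfolding power2_norm_eq_inner by (simp add: inner_simps inner_commute power2_eq_square algebra_simps)
  finally have "\<rho> * (norm (prox y - step a y z))\<^sup>2
      \<le> \<rho> * ((norm (prox y - y))\<^sup>2 + 2 * a * (G y z \<bullet> (prox y - y)) + a\<^sup>2 * (norm (G y z))\<^sup>2)"
    using rho_pos by simp
  with env_le[OF prox_in, of "step a y z" y] show ?thesis
    by (simp add: env_def[of y] algebra_simps)
qed

lemma expected_descent:
  assumes y: "y \<in> X" and a: "0 \<le> a"
  shows "(\<integral>\<^sup>+z. ennreal (env (step a y z) - m) \<partial>D) + ennreal (a / 2 * (norm (grad y))\<^sup>2)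
    \<le> ennreal (env y - m + \<rho> * a\<^sup>2 * L\<^sup>2)"
proof -
  interpret D: prob_space D using unbiased by (simp add: stochastic_oracle_def)
  define v where "v = (\<integral>z. G y z \<partial>D)"
  define q where "q = (\<integral>z. (norm (G y z))\<^sup>2 \<partial>D)"
  have int: "integrable D (G y)" "integrable D (\<lambda>z. (norm (G y z))\<^sup>2)"
    and v: "v \<in> frechet_subdifferential g y" and q: "q \<le> L\<^sup>2"
    using unbiased y by (auto simp: stochastic_oracle_def v_def q_def)
  define u where "u z = env y + 2 * \<rho> * a * (G y z \<bullet> (prox y - y)) + \<rho> * a\<^sup>2 * (norm (G y z))\<^sup>2 - m" for z
  have le: "env (step a y z) - m \<le> u z" for z
    using env_step_le[OF y, of a z] by (simp add: u_def)
  \<comment> \<open>As a majorant of a nonnegative gap, \<open>u\<close> has equal extended and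
    Bochner integrals.\<close>
  have nonneg: "0 \<le> u z" for z
    using le[of z] env_ge[of "step a y z"] by linarith
  have u: "integrable D u" unfolding u_def using int by simp
  have "integral\<^sup>L D u = env y + 2 * \<rho> * a * (v \<bullet> (prox y - y)) + \<rho> * a\<^sup>2 * q - m"
    unfolding u_def v_def q_def using int by (simp add: D.prob_space)
  moreover have "2 * \<rho> * a * (v \<bullet> (prox y - y)) \<le> 2 * \<rho> * a * (- \<rho> * (norm (prox y - y))\<^sup>2)"
    using inner_subgradient_prox_le[OF y v] rho_pos a by (intro mult_left_mono) auto
  moreover have "2 * \<rho> * a * (- \<rho> * (norm (prox y - y))\<^sup>2) = - (a / 2 * (norm (grad y))\<^sup>2)"
    by (simp add: grad_def norm_minus_commute power_mult_distrib power2_eq_square)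
  moreover have "\<rho> * a\<^sup>2 * q \<le> \<rho> * a\<^sup>2 * L\<^sup>2"
    using q rho_pos by (intro mult_left_mono) auto
  ultimately have bound: "integral\<^sup>L D u + a / 2 * (norm (grad y))\<^sup>2 \<le> env y - m + \<rho> * a\<^sup>2 * L\<^sup>2"
    by linarith
  have "(\<integral>\<^sup>+z. ennreal (env (step a y z) - m) \<partial>D) \<le> (\<integral>\<^sup>+z. ennreal (u z) \<partial>D)"
    by (intro nn_integral_mono ennreal_leI le)
  also have "\<dots> = ennreal (integral\<^sup>L D u)"
    using u nonneg by (intro nn_integral_eq_integral) auto
  finally have "(\<integral>\<^sup>+z. ennreal (env (step a y z) - m) \<partial>D) + ennreal (a / 2 * (norm (grad y))\<^sup>2)
      \<le> ennreal (integral\<^sup>L D u) + ennreal (a / 2 * (norm (grad y))\<^sup>2)"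
    by (rule add_right_mono)
  also have "\<dots> = ennreal (integral\<^sup>L D u + a / 2 * (norm (grad y))\<^sup>2)"
    using a nonneg by (intro ennreal_plus[symmetric] integral_nonneg_AE) auto
  also have "\<dots> \<le> ennreal (env y - m + \<rho> * a\<^sup>2 * L\<^sup>2)"
    by (rule ennreal_leI[OF bound])
  finally show ?thesis .
qed

text \<open>The step size depends on the random starting point, so the descent inequality has to be divided
  by it before taking expectations. For \<open>a = 0\<close> the quotients are \<open>0\<close> and the
  inequality remains true at minimizers.\<close>

lemma expected_descent_scaled:
  assumes y: "y \<in> X" and a: "0 \<le> a" "a = 0 \<Longrightarrow> env y = m"
  shows "(\<integral>\<^sup>+z. ennreal ((env (step a y z) - m) / a) \<partial>D) + ennreal ((norm (grad y))\<^sup>2 / 2)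
    \<le> ennreal ((env y - m) / a) + ennreal (\<rho> * a * L\<^sup>2)"
proof (cases "a = 0")
  case True
  then show ?thesis using grad_eq_0[of y] a(2) by simp
next
  case False
  with a have a: "0 < a" by simp
  have [measurable]: "(\<lambda>z. step a y z) \<in> measurable D borel_X"
    using measurable_compose[OF _ measurable_step, of "\<lambda>z. ((a, y), z)" D] y
    by (simp add: space_restrict_space)
  have "(\<integral>\<^sup>+z. ennreal ((env (step a y z) - m) / a) \<partial>D)
      = (\<integral>\<^sup>+z. ennreal (1 / a) * ennreal (env (step a y z) - m) \<partial>D)"
    using a env_ge by (simp flip: ennreal_mult)
  also have "\<dots> = ennreal (1 / a) * (\<integral>\<^sup>+z. ennreal (env (step a y z) - m) \<partial>D)"
    by (rule nn_integral_cmult) measurable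
  moreover have "ennreal ((norm (grad y))\<^sup>2 / 2) = ennreal (1 / a) * ennreal (a / 2 * (norm (grad y))\<^sup>2)"
    using a by (simp flip: ennreal_mult)
  ultimately have "(\<integral>\<^sup>+z. ennreal ((env (step a y z) - m) / a) \<partial>D) + ennreal ((norm (grad y))\<^sup>2 / 2)
      = ennreal (1 / a) * ((\<integral>\<^sup>+z. ennreal (env (step a y z) - m) \<partial>D) + ennreal (a / 2 * (norm (grad y))\<^sup>2))"
    by (simp add: distrib_left)
  also have "\<dots> \<le> ennreal (1 / a) * ennreal (env y - m + \<rho> * a\<^sup>2 * L\<^sup>2)"
    using a y by (intro mult_left_mono expected_descent) auto
  also have "\<dots> = ennreal ((env y - m) / a + \<rho> * a * L\<^sup>2)"
    using a env_ge[of y] rho_pos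
    by (subst ennreal_mult[symmetric])
      (auto intro!: add_nonneg_nonneg simp: add_divide_distrib power2_eq_square)
  also have "\<dots> = ennreal ((env y - m) / a) + ennreal (\<rho> * a * L\<^sup>2)"
    using a env_ge rho_pos by (intro ennreal_plus) auto
  finally show ?thesis .
qed

end

section \<open>Restarts\<close>

lemma Int_stable_vimages: "Int_stable {Z -` A \<inter> \<Omega> | A. A \<in> sets K}"
proof (rule Int_stableI, safe)
  fix A B assume "A \<in> sets K" "B \<in> sets K"
  then show "\<exists>C. Z -` A \<inter> \<Omega> \<inter> (Z -` B \<inter> \<Omega>) = Z -` C \<inter> \<Omega> \<and> C \<in> sets K"
    by (intro exI[of _ "A \<inter> B"]) auto
qed

locale restarted_subgradient_method = subgradient_method g X \<rho> m L D G + prob_space M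
  for g :: "'a::euclidean_space \<Rightarrow> real" and X :: "'a set" and \<rho> m L :: real
    and D :: "'b measure" and G :: "'a \<Rightarrow> 'b \<Rightarrow> 'a" and M :: "'w measure" +
  fixes N :: nat and t :: "nat \<Rightarrow> nat" and \<xi> :: "nat \<Rightarrow> nat \<Rightarrow> 'w \<Rightarrow> 'b"
    and S :: "nat \<Rightarrow> 'w \<Rightarrow> nat" and \<alpha> :: "nat \<Rightarrow> 'w \<Rightarrow> real"
    and x :: "nat \<Rightarrow> 'w \<Rightarrow> 'a" and x0 :: 'a
  assumes inputs: "independent_restart_inputs M D N t \<xi> S"
    and x0_in: "x0 \<in> X"
    and x_0: "\<And>\<omega>. \<omega> \<in> space M \<Longrightarrow> x 0 \<omega> = x0"
    and x_Suc: "\<And>k \<omega>. k < N \<Longrightarrow> \<omega> \<in> space M \<Longrightarrow>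
      x (Suc k) \<omega> = psgm_iterate X G (\<alpha> k \<omega>) (x k \<omega>) (\<lambda>s. \<xi> k s \<omega>) (S k \<omega>)"
    and alpha: "\<And>k \<omega>. k < N \<Longrightarrow> \<omega> \<in> space M \<Longrightarrow>
      \<alpha> k \<omega> = sqrt (env (x k \<omega>) - m) / (sqrt \<rho> * L * sqrt (real (t k) + 1))"
begin

definition events_of :: "(nat \<times> nat) + nat \<Rightarrow> 'w set set" where
  "events_of = case_sum (\<lambda>(k, s). {\<xi> k s -` A \<inter> space M | A. A \<in> sets D})
     (\<lambda>k. {S k -` A \<inter> space M | A. A \<in> sets (count_space {0..t k})})"

definition indices :: "((nat \<times> nat) + nat) set" where
  "indices = Inl ` {(k, s). k < N \<and> s < t k} \<union> Inr ` {k. k < N}"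

definition generated :: "((nat \<times> nat) + nat) set \<Rightarrow> 'w measure" where
  "generated J = sigma (space M) (\<Union>i\<in>J. events_of i)"

text \<open>The inputs consumed before step \<open>s\<close> of outer iteration \<open>k\<close>.\<close>

definition past :: "nat \<Rightarrow> nat \<Rightarrow> ((nat \<times> nat) + nat) set" where
  "past k s = Inl ` {(j, r). j < k \<and> r < t j \<or> j = k \<and> r < s} \<union> Inr ` {..<k}"

text \<open>The inner run at a fixed index \<open>s\<close>. Separating it from the random output
  index keeps it a function of \<open>past k s\<close>, which excludes \<open>S k\<close>.\<close>

definition iter :: "nat \<Rightarrow> nat \<Rightarrow> 'w \<Rightarrow> 'a" where
  "iter k s \<omega> = psgm_iterate X G (\<alpha> k \<omega>) (x k \<omega>) (\<lambda>s. \<xi> k s \<omega>) s"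

lemma indep_inputs: "indep_sets events_of indices"
  and measurable_xi: "k < N \<Longrightarrow> s < t k \<Longrightarrow> \<xi> k s \<in> measurable M D"
  and distr_xi: "k < N \<Longrightarrow> s < t k \<Longrightarrow> distr M D (\<xi> k s) = D"
  and measurable_S: "k < N \<Longrightarrow> S k \<in> measurable M (count_space {0..t k})"
  and distr_S: "k < N \<Longrightarrow> distr M (count_space {0..t k}) (S k) = uniform_count_measure {0..t k}"
  using inputs by (auto simp: independent_restart_inputs_def events_of_def indices_def)

section \<open>The filtration generated by samples and output indices\<close>

lemma events_of_sets: "i \<in> indices \<Longrightarrow> events_of i \<subseteq> sets M"
  using indep_inputs by (simp add: indep_sets_def)

lemma events_of_Int_stable: "Int_stable (events_of i)"
  unfolding events_of_def by (cases i) (auto intro!: Int_stable_vimages simp del: sets_count_space split: prod.split)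

lemma past_subset: "k < N \<Longrightarrow> s \<le> t k \<Longrightarrow> past k s \<subseteq> indices"
  and past_Suc_subset: "k < N \<Longrightarrow> past (Suc k) 0 \<subseteq> indices"
  by (auto simp: past_def indices_def less_Suc_eq)

lemma events_of_Union_sets: "J \<subseteq> indices \<Longrightarrow> (\<Union>i\<in>J. events_of i) \<subseteq> Pow (space M)"
  using events_of_sets sets.sets_into_space by blast

lemma sets_generated: "J \<subseteq> indices \<Longrightarrow> sets (generated J) = sigma_sets (space M) (\<Union>i\<in>J. events_of i)"
  unfolding generated_def by (rule sets_measure_of[OF events_of_Union_sets])

lemma space_generated [simp]: "space (generated J) = space M"
  by (simp add: generated_def space_measure_of_conv)

lemma subalgebra_generated: "J \<subseteq> indices \<Longrightarrow> subalgebra M (generated J)"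
  using events_of_sets by (auto simp: subalgebra_def sets_generated intro!: sets.sigma_sets_subset)

lemma measurable_generated_mono:
  assumes "f \<in> measurable (generated I) K" "I \<subseteq> J" "J \<subseteq> indices"
  shows "f \<in> measurable (generated J) K"
proof (rule measurable_from_subalg[OF _ assms(1)])
  have "sigma_sets (space M) (\<Union>i\<in>I. events_of i) \<subseteq> sigma_sets (space M) (\<Union>i\<in>J. events_of i)"
    using assms(2) by (intro sigma_sets_mono') auto
  with assms show "subalgebra (generated J) (generated I)"
    by (auto simp: subalgebra_def sets_generated)
qed

lemma events_of_in_generated: "i \<in> J \<Longrightarrow> J \<subseteq> indices \<Longrightarrow> A \<in> events_of i \<Longrightarrow> A \<in> sets (generated J)"
  by (auto simp: sets_generated intro: sigma_sets.Basic)

lemma xi_measurable_generated: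
  assumes "J \<subseteq> indices" "Inl (k, s) \<in> J"
  shows "\<xi> k s \<in> measurable (generated J) D"
proof (rule measurableI)
  have ks: "k < N" "s < t k" using assms by (auto simp: indices_def)
  show "\<xi> k s \<omega> \<in> space D" if "\<omega> \<in> space (generated J)" for \<omega>
    using measurable_space[OF measurable_xi[OF ks]] that by simp
  show "\<xi> k s -` A \<inter> space (generated J) \<in> sets (generated J)" if "A \<in> sets D" for A
    using that by (intro events_of_in_generated[OF assms(2,1)]) (auto simp: events_of_def)
qed

lemma S_measurable_generated:
  assumes "J \<subseteq> indices" "Inr k \<in> J"
  shows "S k \<in> measurable (generated J) (count_space {0..t k})"
proof (rule measurableI)
  have k: "k < N" using assms by (auto simp: indices_def)
  show "S k \<omega> \<in> space (count_space {0..t k})" if "\<omega> \<in> space (generated J)" for \<omega>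
    using measurable_space[OF measurable_S[OF k]] that by simp
  show "S k -` A \<inter> space (generated J) \<in> sets (generated J)" if "A \<in> sets (count_space {0..t k})" for A
    using that by (intro events_of_in_generated[OF assms(2,1)]) (auto simp: events_of_def)
qed

text \<open>Disjoint groups of independent families stable under intersection generate independent
  sigma-algebras; the two groups are \<open>J\<close> and the single input \<open>i\<close>.\<close>

lemma indep_generated:
  assumes J: "J \<subseteq> indices" and i: "i \<in> indices" "i \<notin> J"
  shows "indep_set (sets (generated J)) (events_of i)"
proof -
  define I where "I = case_bool J {i}"
  have "indep_sets events_of (\<Union>b\<in>UNIV. I b)"
    using J i by (intro indep_sets_mono_index[OF _ indep_inputs]) (auto simp: I_def UNIV_bool)
  moreover have "disjoint_family_on I UNIV"
    using i by (auto simp: disjoint_family_on_def I_def split: bool.split)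
  ultimately have "indep_sets (\<lambda>b. sigma_sets (space M) (\<Union>i\<in>I b. events_of i)) UNIV"
    by (intro indep_sets_collect_sigma events_of_Int_stable)
  then show ?thesis
    unfolding indep_set_def
    by (rule indep_sets_mono_sets) (auto simp: I_def sets_generated[OF J] split: bool.split)
qed

section \<open>Adaptedness of the iterates\<close>

lemma iter_0: "iter k 0 \<omega> = x k \<omega>"
  and iter_Suc: "iter k (Suc s) \<omega> = step (\<alpha> k \<omega>) (iter k s \<omega>) (\<xi> k s \<omega>)"
  by (simp_all add: iter_def step_def)

lemma x_Suc_iter: "k < N \<Longrightarrow> \<omega> \<in> space M \<Longrightarrow> x (Suc k) \<omega> = iter k (S k \<omega>) \<omega>"
  by (simp add: x_Suc iter_def)

text \<open>The step size depends only on \<open>x k\<close>, and step \<open>s\<close> consumes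
  just \<open>\<xi> k s\<close>, which enters the past at \<open>Suc s\<close>. Hence the pair at
  \<open>s\<close> is independent of the sample about to be drawn.\<close>

lemma iter_measurable:
  assumes k: "k < N" and x: "x k \<in> measurable (generated (past k 0)) borel_X" and s: "s \<le> t k"
  shows "(\<lambda>\<omega>. (\<alpha> k \<omega>, iter k s \<omega>)) \<in> measurable (generated (past k s)) (borel \<Otimes>\<^sub>M borel_X)"
  using s
proof (induction s)
  case 0
  have "(\<lambda>\<omega>. sqrt (env (x k \<omega>) - m) / (sqrt \<rho> * L * sqrt (real (t k) + 1)))
      \<in> borel_measurable (generated (past k 0))"
    using measurable_compose[OF x measurable_env] by simp
  then have "\<alpha> k \<in> borel_measurable (generated (past k 0))"
    using alpha[OF k] by (subst measurable_cong) auto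
  with x show ?case by (simp add: iter_0)
next
  case (Suc s)
  have sub: "past k (Suc s) \<subseteq> indices" using past_subset[OF k Suc.prems] .
  have Y: "(\<lambda>\<omega>. (\<alpha> k \<omega>, iter k s \<omega>)) \<in> measurable (generated (past k (Suc s))) (borel \<Otimes>\<^sub>M borel_X)"
    using Suc by (intro measurable_generated_mono[OF _ _ sub]) (auto simp: past_def)
  have "\<xi> k s \<in> measurable (generated (past k (Suc s))) D"
    using sub by (rule xi_measurable_generated) (simp add: past_def)
  from measurable_compose[OF measurable_Pair[OF Y this] measurable_step]
  have "iter k (Suc s) \<in> measurable (generated (past k (Suc s))) borel_X"
    by (simp add: iter_Suc[abs_def])
  moreover have "\<alpha> k \<in> borel_measurable (generated (past k (Suc s)))"
    using measurable_compose[OF Y measurable_fst] by simp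
  ultimately show ?case by simp
qed

lemma x_measurable: "k \<le> N \<Longrightarrow> x k \<in> measurable (generated (past k 0)) borel_X"
proof (induction k)
  case 0
  have "(\<lambda>_. x0) \<in> measurable (generated (past 0 0)) borel_X"
    using x0_in by (simp add: space_restrict_space)
  then show ?case using x_0 by (subst measurable_cong) auto
next
  case (Suc k)
  then have k: "k < N" by simp
  note sub = past_Suc_subset[OF k]
  have "iter k s \<in> measurable (generated (past (Suc k) 0)) borel_X" if s: "s \<le> t k" for s
  proof -
    have "(\<lambda>\<omega>. (\<alpha> k \<omega>, iter k s \<omega>)) \<in> measurable (generated (past (Suc k) 0)) (borel \<Otimes>\<^sub>M borel_X)"
      using iter_measurable[OF k _ s] Suc s
      by (intro measurable_generated_mono[OF _ _ sub]) (auto simp: past_def)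
    from measurable_compose[OF this measurable_snd] show ?thesis by simp
  qed
  moreover have "S k \<in> measurable (generated (past (Suc k) 0)) (count_space {0..t k})"
    using sub by (rule S_measurable_generated) (simp add: past_def)
  \<comment> \<open>A random index with countably many values selects from a family of measurable
    maps.\<close>
  ultimately have "(\<lambda>\<omega>. iter k (S k \<omega>) \<omega>) \<in> measurable (generated (past (Suc k) 0)) borel_X"
    by (intro measurable_compose_countable'[where f = "iter k" and g = "S k" and I = "{0..t k}"]) auto
  then show ?case using x_Suc_iter[OF k] by (subst measurable_cong) auto
qed

lemma x_measurable_M [measurable]: "k \<le> N \<Longrightarrow> x k \<in> measurable M borel_X"
proof -
  assume k: "k \<le> N"
  have "past k 0 \<subseteq> indices"
    \<comment> \<open>Passing through \<open>k - 1\<close> also covers the final iterate,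
      \<open>k = N\<close>.\<close>
    using k past_Suc_subset[of "k - 1"] by (cases k) (auto simp: past_def)
  then show "x k \<in> measurable M borel_X"
    using measurable_from_subalg[OF subalgebra_generated x_measurable[OF k]] by simp
qed

lemma x_in: "k \<le> N \<Longrightarrow> \<omega> \<in> space M \<Longrightarrow> x k \<omega> \<in> X"
  using measurable_space[OF x_measurable_M] by (simp add: space_restrict_space)

lemma
  assumes k: "k < N" and s: "s \<le> t k"
  shows alpha_iter_measurable_M: "(\<lambda>\<omega>. (\<alpha> k \<omega>, iter k s \<omega>)) \<in> measurable M (borel \<Otimes>\<^sub>M borel_X)"
    and alpha_measurable_M: "\<alpha> k \<in> borel_measurable M"
    and iter_measurable_M: "iter k s \<in> measurable M borel_X"
proof -
  show Y: "(\<lambda>\<omega>. (\<alpha> k \<omega>, iter k s \<omega>)) \<in> measurable M (borel \<Otimes>\<^sub>M borel_X)"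
    using measurable_from_subalg[OF subalgebra_generated[OF past_subset[OF k s]]
        iter_measurable[OF k x_measurable s]] k by simp
  show "\<alpha> k \<in> borel_measurable M" "iter k s \<in> measurable M borel_X"
    using measurable_compose[OF Y measurable_fst] measurable_compose[OF Y measurable_snd] by simp_all
qed

lemma iter_in: "k < N \<Longrightarrow> s \<le> t k \<Longrightarrow> \<omega> \<in> space M \<Longrightarrow> iter k s \<omega> \<in> X"
  using measurable_space[OF iter_measurable_M] by (simp add: space_restrict_space)

lemma alpha_nonneg: "k < N \<Longrightarrow> \<omega> \<in> space M \<Longrightarrow> 0 \<le> \<alpha> k \<omega>"
  using alpha env_ge L_pos rho_pos by simp

text \<open>With step size 0 the iterates never leave \<open>x k\<close>, which projection fixes,
  and a zero step size means that the gap at \<open>x k\<close> vanishes.\<close>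

lemma alpha_eq_0:
  assumes "k < N" "s \<le> t k" "\<omega> \<in> space M" "\<alpha> k \<omega> = 0"
  shows "env (iter k s \<omega>) = m"
proof -
  have "iter k s \<omega> = x k \<omega>"
    using assms(2)
  proof (induction s)
    case (Suc s)
    then show ?case
      using x_in[of k \<omega>] assms by (simp add: iter_Suc step_def closest_point_self)
  qed (simp add: iter_0)
  then show ?thesis
    using assms alpha[OF assms(1,3)] rho_pos L_pos by simp
qed

text \<open>The fresh sample is integrated out against \<open>D\<close>, and
  \<open>expected_descent_scaled\<close> is then applied for each outcome of the past.\<close>

lemma iter_descent:
  assumes k: "k < N" and s: "s < t k"
  shows "(\<integral>\<^sup>+\<omega>. ennreal ((env (iter k (Suc s) \<omega>) - m) / \<alpha> k \<omega>) \<partial>M)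
      + (\<integral>\<^sup>+\<omega>. ennreal ((norm (grad (iter k s \<omega>)))\<^sup>2 / 2) \<partial>M)
    \<le> (\<integral>\<^sup>+\<omega>. ennreal ((env (iter k s \<omega>) - m) / \<alpha> k \<omega>) \<partial>M)
      + (\<integral>\<^sup>+\<omega>. ennreal (\<rho> * \<alpha> k \<omega> * L\<^sup>2) \<partial>M)"
proof -
  interpret D: prob_space D using unbiased by (simp add: stochastic_oracle_def)
  have s': "s \<le> t k" using s by simp
  note [measurable] = alpha_measurable_M[OF k s'] iter_measurable_M[OF k s']
  have stepm: "(\<lambda>p. step (fst (fst p)) (snd (fst p)) (snd p)) \<in> measurable ((borel \<Otimes>\<^sub>M borel_X) \<Otimes>\<^sub>M D) borel_X"
    using measurable_step by (simp add: case_prod_unfold)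
  define h where "h p = ennreal ((env (step (fst (fst p)) (snd (fst p)) (snd p)) - m) / fst (fst p))" for p
  have h [measurable]: "h \<in> borel_measurable ((borel \<Otimes>\<^sub>M borel_X) \<Otimes>\<^sub>M D)"
    unfolding h_def using measurable_compose[OF stepm measurable_env] by measurable
  have "indep_set (sets (generated (past k s))) (events_of (Inl (k, s)))"
    using k s by (intro indep_generated past_subset) (auto simp: indices_def past_def)
  then have indep: "indep_set (sets (generated (past k s))) {\<xi> k s -` A \<inter> space M | A. A \<in> sets D}"
    by (simp add: events_of_def)
  have "(\<integral>\<^sup>+\<omega>. ennreal ((env (iter k (Suc s) \<omega>) - m) / \<alpha> k \<omega>) \<partial>M)
      = (\<integral>\<^sup>+\<omega>. h ((\<alpha> k \<omega>, iter k s \<omega>), \<xi> k s \<omega>) \<partial>M)"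
    by (simp add: h_def iter_Suc)
  also have "\<dots> = (\<integral>\<^sup>+\<omega>. \<integral>\<^sup>+z. h ((\<alpha> k \<omega>, iter k s \<omega>), z) \<partial>distr M D (\<xi> k s) \<partial>M)"
    using k s by (intro nn_integral_indep_pair[OF subalgebra_generated[OF past_subset]
        iter_measurable measurable_xi indep h] x_measurable) auto
  also have "\<dots> = (\<integral>\<^sup>+\<omega>. \<integral>\<^sup>+z. ennreal ((env (step (\<alpha> k \<omega>) (iter k s \<omega>) z) - m) / \<alpha> k \<omega>) \<partial>D \<partial>M)"
    using k s by (simp add: distr_xi h_def)
  finally have eq: "(\<integral>\<^sup>+\<omega>. ennreal ((env (iter k (Suc s) \<omega>) - m) / \<alpha> k \<omega>) \<partial>M)
      = (\<integral>\<^sup>+\<omega>. \<integral>\<^sup>+z. ennreal ((env (step (\<alpha> k \<omega>) (iter k s \<omega>) z) - m) / \<alpha> k \<omega>) \<partial>D \<partial>M)" .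
  have "(\<lambda>p. \<integral>\<^sup>+z. h (p, z) \<partial>D) \<in> borel_measurable (borel \<Otimes>\<^sub>M borel_X)"
    using D.borel_measurable_nn_integral_fst[OF h] .
  from measurable_compose[OF alpha_iter_measurable_M[OF k s'] this]
  have [measurable]: "(\<lambda>\<omega>. \<integral>\<^sup>+z. ennreal ((env (step (\<alpha> k \<omega>) (iter k s \<omega>) z) - m) / \<alpha> k \<omega>) \<partial>D)
      \<in> borel_measurable M"
    by (simp add: h_def)
  have "(\<integral>\<^sup>+\<omega>. ennreal ((env (iter k (Suc s) \<omega>) - m) / \<alpha> k \<omega>) \<partial>M)
      + (\<integral>\<^sup>+\<omega>. ennreal ((norm (grad (iter k s \<omega>)))\<^sup>2 / 2) \<partial>M)
    = (\<integral>\<^sup>+\<omega>. (\<integral>\<^sup>+z. ennreal ((env (step (\<alpha> k \<omega>) (iter k s \<omega>) z) - m) / \<alpha> k \<omega>) \<partial>D)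
        + ennreal ((norm (grad (iter k s \<omega>)))\<^sup>2 / 2) \<partial>M)"
    unfolding eq by (subst nn_integral_add) (auto intro: measurable_compose[OF iter_measurable_M[OF k s']])
  also have "\<dots> \<le> (\<integral>\<^sup>+\<omega>. ennreal ((env (iter k s \<omega>) - m) / \<alpha> k \<omega>) + ennreal (\<rho> * \<alpha> k \<omega> * L\<^sup>2) \<partial>M)"
    using k s by (intro nn_integral_mono expected_descent_scaled iter_in alpha_nonneg alpha_eq_0) auto
  also have "\<dots> = (\<integral>\<^sup>+\<omega>. ennreal ((env (iter k s \<omega>) - m) / \<alpha> k \<omega>) \<partial>M)
      + (\<integral>\<^sup>+\<omega>. ennreal (\<rho> * \<alpha> k \<omega> * L\<^sup>2) \<partial>M)"
    by (rule nn_integral_add) measurable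
  finally show ?thesis .
qed

end

section \<open>Rate of convergence\<close>

text \<open>The output index ranges over \<open>n + 1\<close> values but there are only
  \<open>n\<close> steps, so the last summand has its own hypothesis.\<close>

lemma telescoping_ennreal:
  fixes a b :: "nat \<Rightarrow> ennreal"
  assumes "\<And>s. s < n \<Longrightarrow> a (Suc s) + b s \<le> a s + c" and "b n \<le> a n + c"
  shows "(\<Sum>s\<le>n. b s) \<le> a 0 + of_nat (Suc n) * c"
proof -
  \<comment> \<open>The term \<open>a r\<close> stays on the left because extended reals cannot be
    subtracted freely.\<close>
  have "a r + (\<Sum>s<r. b s) \<le> a 0 + of_nat r * c" if "r \<le> n" for r
    using that
  proof (induction r)
    case (Suc r)
    have "a (Suc r) + (\<Sum>s<Suc r. b s) = (a (Suc r) + b r) + (\<Sum>s<r. b s)"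
      by (simp add: ac_simps)
    also have "\<dots> \<le> (a r + c) + (\<Sum>s<r. b s)"
      using assms(1)[of r] Suc.prems by (intro add_right_mono) simp
    also have "\<dots> = (a r + (\<Sum>s<r. b s)) + c" by (simp add: ac_simps)
    also have "\<dots> \<le> (a 0 + of_nat r * c) + c"
      using Suc by (intro add_right_mono) simp
    finally show ?case by (simp add: distrib_left distrib_right ac_simps)
  qed simp
  from this[of n] have *: "a n + (\<Sum>s<n. b s) \<le> a 0 + of_nat n * c" by simp
  have "(\<Sum>s\<le>n. b s) = b n + (\<Sum>s<n. b s)"
    by (simp add: lessThan_Suc_atMost[symmetric] add.commute)
  also have "\<dots> \<le> (a n + (\<Sum>s<n. b s)) + c"
    using add_right_mono[OF assms(2), of "\<Sum>s<n. b s"] by (simp add: ac_simps)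
  also have "\<dots> \<le> (a 0 + of_nat n * c) + c"
    using * by (rule add_right_mono)
  finally show ?thesis by (simp add: distrib_left distrib_right ac_simps)
qed

text \<open>The tangent inequality for the convex power \<open>u powr p\<close> at \<open>m\<close>,
  divided by its slope there. Being affine in \<open>u\<close>, it yields Jensen's inequality by
  integration. It follows from Young's inequality for \<open>u / m\<close> and 1.\<close>

lemma powr_ge_tangent:
  fixes u m p :: real
  assumes "0 \<le> u" "0 < m" "1 \<le> p"
  shows "u + m / p \<le> m + u powr p / (p * m powr (p - 1))"
proof (cases "p = 1")
  case True
  then show ?thesis using assms by simp
next
  case False
  then have p: "1 < p" using assms by simp
  define q where "q = p / (p - 1)"
  have "u / m * 1 \<le> (u / m) powr p / p + 1 powr q / q"
    using assms p by (intro Youngs_inequality) (auto simp: q_def field_simps)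
  also have "\<dots> = u powr p / (p * m powr p) + 1 - 1 / p"
    using assms p by (simp add: q_def powr_divide field_simps)
  finally have "m * (u / m) \<le> m * (u powr p / (p * m powr p) + 1 - 1 / p)"
    using assms by (intro mult_left_mono) auto
  also have "\<dots> = u powr p / (p * m powr (p - 1)) + m - m / p"
    using assms p by (simp add: powr_diff field_simps)
  finally show ?thesis using assms by simp
qed

section \<open>Contraction of the expected gap\<close>

context restarted_subgradient_method
begin

text \<open>Splitting by the value of \<open>S k\<close>, each inner iterate is independent of the
  output index, and each index has probability 1/(t k + 1).\<close>

lemma nn_integral_x_Suc:
  assumes k: "k < N" and h [measurable]: "h \<in> borel_measurable borel_X"
  shows "(\<integral>\<^sup>+\<omega>. h (x (Suc k) \<omega>) \<partial>M)
    = ennreal (1 / (real (t k) + 1)) * (\<Sum>s\<le>t k. \<integral>\<^sup>+\<omega>. h (iter k s \<omega>) \<partial>M)"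
proof -
  let ?U = "count_space {0..t k}"
  have [measurable]: "S k \<in> measurable M ?U" using k by (rule measurable_S)
  have m [measurable]: "(\<lambda>\<omega>. h (iter k s \<omega>)) \<in> borel_measurable M" if "s \<le> t k" for s
    using iter_measurable_M[OF k that] h by (rule measurable_compose)
  have pt: "(\<integral>\<^sup>+\<omega>. h (iter k s \<omega>) * indicator {s} (S k \<omega>) \<partial>M)
      = ennreal (1 / (real (t k) + 1)) * (\<integral>\<^sup>+\<omega>. h (iter k s \<omega>) \<partial>M)" if s: "s \<le> t k" for s
  proof -
    define H where "H p = h (snd (fst p)) * indicator {s} (snd p)" for p :: "(real \<times> 'a) \<times> nat"
    have ind: "(indicator {s} :: nat \<Rightarrow> ennreal) \<in> borel_measurable ?U" by simp
    have H: "H \<in> borel_measurable ((borel \<Otimes>\<^sub>M borel_X) \<Otimes>\<^sub>M ?U)"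
      unfolding H_def using measurable_compose[OF measurable_snd ind] by measurable
    have "indep_set (sets (generated (past k s))) (events_of (Inr k))"
      using k s by (intro indep_generated past_subset) (auto simp: indices_def past_def)
    then have indep: "indep_set (sets (generated (past k s))) {S k -` A \<inter> space M | A. A \<in> sets ?U}"
      by (simp add: events_of_def del: sets_count_space)
    have "(\<integral>\<^sup>+\<omega>. h (iter k s \<omega>) * indicator {s} (S k \<omega>) \<partial>M)
        = (\<integral>\<^sup>+\<omega>. H ((\<alpha> k \<omega>, iter k s \<omega>), S k \<omega>) \<partial>M)"
      by (simp add: H_def)
    also have "\<dots> = (\<integral>\<^sup>+\<omega>. \<integral>\<^sup>+z. H ((\<alpha> k \<omega>, iter k s \<omega>), z) \<partial>distr M ?U (S k) \<partial>M)"
      using k s by (intro nn_integral_indep_pair[OF subalgebra_generated[OF past_subset]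
          iter_measurable measurable_S indep H] x_measurable) auto
    also have "\<dots> = (\<integral>\<^sup>+\<omega>. h (iter k s \<omega>) * (\<integral>\<^sup>+z. indicator {s} z \<partial>uniform_count_measure {0..t k}) \<partial>M)"
      using k by (simp add: distr_S H_def nn_integral_cmult sets_uniform_count_measure)
    also have "(\<integral>\<^sup>+z. indicator {s} z \<partial>uniform_count_measure {0..t k}) = ennreal (1 / (real (t k) + 1))"
      using s by (simp add: sets_uniform_count_measure emeasure_uniform_count_measure add.commute)
    finally show ?thesis
      using nn_integral_cmult[OF m[OF s], of "ennreal (1 / (real (t k) + 1))"]
      by (simp add: mult.commute)
  qed
  have "(\<integral>\<^sup>+\<omega>. h (x (Suc k) \<omega>) \<partial>M) = (\<integral>\<^sup>+\<omega>. (\<Sum>s\<le>t k. h (iter k s \<omega>) * indicator {s} (S k \<omega>)) \<partial>M)"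
  proof (rule nn_integral_cong)
    fix \<omega> assume \<omega>: "\<omega> \<in> space M"
    have "S k \<omega> \<le> t k" using measurable_space[OF measurable_S[OF k] \<omega>] by simp
    then show "h (x (Suc k) \<omega>) = (\<Sum>s\<le>t k. h (iter k s \<omega>) * indicator {s} (S k \<omega>))"
      by (simp add: x_Suc_iter[OF k \<omega>] indicator_def if_distrib cong: if_cong)
  qed
  also have "\<dots> = (\<Sum>s\<le>t k. \<integral>\<^sup>+\<omega>. h (iter k s \<omega>) * indicator {s} (S k \<omega>) \<partial>M)"
  proof (rule nn_integral_sum)
    fix s assume s: "s \<in> {..t k}"
    have [measurable]: "(\<lambda>\<omega>. indicator {s} (S k \<omega>) :: ennreal) \<in> borel_measurable M"
      by (rule measurable_compose[of "S k" _ ?U]) auto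
    have [measurable]: "(\<lambda>\<omega>. h (iter k s \<omega>)) \<in> borel_measurable M"
      using m s by simp
    show "(\<lambda>\<omega>. h (iter k s \<omega>) * indicator {s} (S k \<omega>)) \<in> borel_measurable M"
      by measurable
  qed
  also have "\<dots> = ennreal (1 / (real (t k) + 1)) * (\<Sum>s\<le>t k. \<integral>\<^sup>+\<omega>. h (iter k s \<omega>) \<partial>M)"
    by (simp add: pt sum_distrib_left)
  finally show ?thesis .
qed

text \<open>The step size balances the telescoped sum: with \<kappa> = sqrt \<rho> L and
  \<open>r = sqrt (t k + 1)\<close>, the initial gap over the step size and the
  \<open>r\<^sup>2\<close> error terms both contribute \<kappa> r times the root of the gap.
  Averaging and undoing the factor 1/2 leaves 4 \<kappa> / r.\<close>

lemma expected_gradient_le: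
  assumes k: "k < N"
  shows "(\<integral>\<^sup>+\<omega>. ennreal ((norm (grad (x (Suc k) \<omega>)))\<^sup>2) \<partial>M)
    \<le> ennreal (4 * sqrt \<rho> * L / sqrt (real (t k) + 1)) * (\<integral>\<^sup>+\<omega>. ennreal (sqrt (env (x k \<omega>) - m)) \<partial>M)"
proof -
  define r where "r = sqrt (real (t k) + 1)"
  have r: "r > 0" "r\<^sup>2 = real (t k) + 1" by (simp_all add: r_def)
  define Q where "Q = (\<integral>\<^sup>+\<omega>. ennreal (sqrt (env (x k \<omega>) - m)) \<partial>M)"
  define \<kappa> where "\<kappa> = sqrt \<rho> * L"
  have \<kappa>: "\<kappa> > 0" "\<kappa>\<^sup>2 = \<rho> * L\<^sup>2" using rho_pos L_pos by (simp_all add: \<kappa>_def power_mult_distrib)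
  have kN: "k \<le> N" using k by simp
  have xm [measurable]: "(\<lambda>\<omega>. env (x k \<omega>)) \<in> borel_measurable M"
    using x_measurable_M[OF kN] measurable_env by (rule measurable_compose)
  have gm [measurable]: "(\<lambda>y. ennreal ((norm (grad y))\<^sup>2 / 2)) \<in> borel_measurable borel_X" by measurable
  have al: "\<alpha> k \<omega> = sqrt (env (x k \<omega>) - m) / (\<kappa> * r)" if "\<omega> \<in> space M" for \<omega>
    using alpha[OF k that] by (simp add: \<kappa>_def r_def)
  have "(\<integral>\<^sup>+\<omega>. ennreal ((env (iter k 0 \<omega>) - m) / \<alpha> k \<omega>) \<partial>M)
      = (\<integral>\<^sup>+\<omega>. ennreal (\<kappa> * r) * ennreal (sqrt (env (x k \<omega>) - m)) \<partial>M)"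
  proof (rule nn_integral_cong)
    fix \<omega> assume "\<omega> \<in> space M"
    then have "(env (iter k 0 \<omega>) - m) / \<alpha> k \<omega>
        = (sqrt (env (x k \<omega>) - m) * sqrt (env (x k \<omega>) - m)) / (sqrt (env (x k \<omega>) - m) / (\<kappa> * r))"
      using env_ge[of "x k \<omega>"] by (simp add: iter_0 al)
    also have "\<dots> = \<kappa> * r * sqrt (env (x k \<omega>) - m)"
    proof -
      \<comment> \<open>Valid at gap zero too, since division by zero gives zero.\<close>
      have "(q * q) / (q / v) = v * q" for q v :: real by (cases "q = 0") simp_all
      then show ?thesis .
    qed
    finally have "(env (iter k 0 \<omega>) - m) / \<alpha> k \<omega> = \<kappa> * r * sqrt (env (x k \<omega>) - m)" .
    then show "ennreal ((env (iter k 0 \<omega>) - m) / \<alpha> k \<omega>) = ennreal (\<kappa> * r) * ennreal (sqrt (env (x k \<omega>) - m))"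
      using \<kappa> r env_ge by (simp flip: ennreal_mult)
  qed
  then have a0: "(\<integral>\<^sup>+\<omega>. ennreal ((env (iter k 0 \<omega>) - m) / \<alpha> k \<omega>) \<partial>M) = ennreal (\<kappa> * r) * Q"
    by (simp add: nn_integral_cmult Q_def)
  have "(\<integral>\<^sup>+\<omega>. ennreal (\<rho> * \<alpha> k \<omega> * L\<^sup>2) \<partial>M)
      = (\<integral>\<^sup>+\<omega>. ennreal (\<kappa> / r) * ennreal (sqrt (env (x k \<omega>) - m)) \<partial>M)"
  proof (rule nn_integral_cong)
    fix \<omega> assume "\<omega> \<in> space M"
    from al[OF this] have "\<rho> * \<alpha> k \<omega> * L\<^sup>2 = \<kappa>\<^sup>2 * (sqrt (env (x k \<omega>) - m) / (\<kappa> * r))"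
      by (simp add: \<kappa>(2))
    also have "\<dots> = \<kappa> / r * sqrt (env (x k \<omega>) - m)"
      using \<kappa>(1) by (simp add: power2_eq_square)
    finally show "ennreal (\<rho> * \<alpha> k \<omega> * L\<^sup>2) = ennreal (\<kappa> / r) * ennreal (sqrt (env (x k \<omega>) - m))"
      using \<kappa>(1) r(1) env_ge by (simp flip: ennreal_mult)
  qed
  then have c: "(\<integral>\<^sup>+\<omega>. ennreal (\<rho> * \<alpha> k \<omega> * L\<^sup>2) \<partial>M) = ennreal (\<kappa> / r) * Q"
    by (simp add: nn_integral_cmult Q_def)
  \<comment> \<open>No sample is drawn after index \<open>t k\<close>. The descent inequality for a
    virtual further step, integrated over \<open>D\<close>, still bounds the gradient once its
    nonnegative first term is dropped.\<close>
  have last: "(\<integral>\<^sup>+\<omega>. ennreal ((norm (grad (iter k (t k) \<omega>)))\<^sup>2 / 2) \<partial>M)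
      \<le> (\<integral>\<^sup>+\<omega>. ennreal ((env (iter k (t k) \<omega>) - m) / \<alpha> k \<omega>) \<partial>M)
        + (\<integral>\<^sup>+\<omega>. ennreal (\<rho> * \<alpha> k \<omega> * L\<^sup>2) \<partial>M)"
  proof -
    note [measurable] = alpha_measurable_M[OF k order_refl]
      measurable_compose[OF iter_measurable_M[OF k order_refl] measurable_env]
    have "ennreal ((norm (grad (iter k (t k) \<omega>)))\<^sup>2 / 2)
        \<le> ennreal ((env (iter k (t k) \<omega>) - m) / \<alpha> k \<omega>) + ennreal (\<rho> * \<alpha> k \<omega> * L\<^sup>2)"
      if "\<omega> \<in> space M" for \<omega>
      by (rule order_trans[OF add_increasing[OF zero_le order_refl] expected_descent_scaled])
        (use k that iter_in alpha_nonneg alpha_eq_0 in auto)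
    then have "(\<integral>\<^sup>+\<omega>. ennreal ((norm (grad (iter k (t k) \<omega>)))\<^sup>2 / 2) \<partial>M)
        \<le> (\<integral>\<^sup>+\<omega>. ennreal ((env (iter k (t k) \<omega>) - m) / \<alpha> k \<omega>) + ennreal (\<rho> * \<alpha> k \<omega> * L\<^sup>2) \<partial>M)"
      by (rule nn_integral_mono)
    then show ?thesis by (subst (asm) nn_integral_add) measurable
  qed
  have sum: "(\<Sum>s\<le>t k. \<integral>\<^sup>+\<omega>. ennreal ((norm (grad (iter k s \<omega>)))\<^sup>2 / 2) \<partial>M)
      \<le> ennreal (\<kappa> * r) * Q + of_nat (Suc (t k)) * (ennreal (\<kappa> / r) * Q)"
    using telescoping_ennreal[OF iter_descent[OF k] last] unfolding a0 c .
  have "of_nat (Suc (t k)) = ennreal (r\<^sup>2)"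
    by (simp add: r(2) ennreal_of_nat_eq_real_of_nat add.commute)
  then have "of_nat (Suc (t k)) * (ennreal (\<kappa> / r) * Q) = ennreal (r\<^sup>2) * ennreal (\<kappa> / r) * Q"
    by (simp add: mult.assoc)
  also have "ennreal (r\<^sup>2) * ennreal (\<kappa> / r) = ennreal (r\<^sup>2 * (\<kappa> / r))"
    using \<kappa>(1) r(1) by (intro ennreal_mult[symmetric]) auto
  also have "r\<^sup>2 * (\<kappa> / r) = \<kappa> * r"
    using r(1) by (simp add: power2_eq_square)
  finally have sum': "(\<Sum>s\<le>t k. \<integral>\<^sup>+\<omega>. ennreal ((norm (grad (iter k s \<omega>)))\<^sup>2 / 2) \<partial>M)
      \<le> ennreal (2 * \<kappa> * r) * Q"
    using sum \<kappa>(1) r(1) by (simp add: distrib_right[symmetric] ennreal_plus[symmetric] del: ennreal_plus)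
  have gxm: "(\<lambda>\<omega>. ennreal ((norm (grad (x (Suc k) \<omega>)))\<^sup>2 / 2)) \<in> borel_measurable M"
    using measurable_compose[OF x_measurable_M gm] k by simp
  have "(\<integral>\<^sup>+\<omega>. ennreal ((norm (grad (x (Suc k) \<omega>)))\<^sup>2) \<partial>M)
      = (\<integral>\<^sup>+\<omega>. ennreal 2 * ennreal ((norm (grad (x (Suc k) \<omega>)))\<^sup>2 / 2) \<partial>M)"
    by (subst ennreal_mult[symmetric]) auto
  also have "\<dots> = ennreal 2 * (\<integral>\<^sup>+\<omega>. ennreal ((norm (grad (x (Suc k) \<omega>)))\<^sup>2 / 2) \<partial>M)"
    by (rule nn_integral_cmult[OF gxm])
  also have "\<dots> = ennreal 2 * (ennreal (1 / r\<^sup>2)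
      * (\<Sum>s\<le>t k. \<integral>\<^sup>+\<omega>. ennreal ((norm (grad (iter k s \<omega>)))\<^sup>2 / 2) \<partial>M))"
    unfolding nn_integral_x_Suc[OF k gm] r(2) ..
  also have "\<dots> \<le> ennreal 2 * (ennreal (1 / r\<^sup>2) * (ennreal (2 * \<kappa> * r) * Q))"
    by (intro mult_left_mono sum') auto
  also have "\<dots> = ennreal 2 * (ennreal (1 / r\<^sup>2) * ennreal (2 * \<kappa> * r)) * Q"
    by (simp only: mult.assoc)
  also have "ennreal 2 * (ennreal (1 / r\<^sup>2) * ennreal (2 * \<kappa> * r)) = ennreal (2 * (1 / r\<^sup>2 * (2 * \<kappa> * r)))"
    using \<kappa>(1) r(1) by (subst ennreal_mult[symmetric], simp, simp, subst ennreal_mult[symmetric]) simp_all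
  also have "2 * (1 / r\<^sup>2 * (2 * \<kappa> * r)) = 4 * sqrt \<rho> * L / sqrt (real (t k) + 1)"
    using r(1) by (simp add: \<kappa>_def r_def[symmetric] power2_eq_square)
  finally show ?thesis unfolding Q_def .
qed

lemma expected_gap_le:
  assumes c: "c > 0" and \<theta>: "1 / 2 \<le> \<theta>"
    and KL: "AE \<omega> in M. \<forall>k\<le>N. c * (env (x k \<omega>) - m) powr \<theta> \<le> norm (grad (x k \<omega>))"
    and \<Delta>: "\<Delta> = env x0 - m" "\<Delta> > 0"
    and t: "\<And>k. k < N \<Longrightarrow> real (t k) = 16 * c powi (-4) * \<rho> * L\<^sup>2 * \<Delta> powr (1 - 4 * \<theta>)
      * exp (4 * \<theta> * \<gamma>) * exp ((4 * \<theta> - 1) * \<gamma> * real k)"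
  shows "k \<le> N \<Longrightarrow> (\<integral>\<^sup>+\<omega>. ennreal (env (x k \<omega>) - m) \<partial>M) \<le> ennreal (\<Delta> * exp (- \<gamma> * real k))"
proof (induction k)
  case 0
  have "(\<integral>\<^sup>+\<omega>. ennreal (env (x 0 \<omega>) - m) \<partial>M) = (\<integral>\<^sup>+\<omega>. ennreal \<Delta> \<partial>M)"
    by (intro nn_integral_cong) (simp add: x_0 \<Delta>)
  then show ?case by (simp add: emeasure_space_1)
next
  case (Suc k)
  then have k: "k < N" by simp
  \<comment> \<open>\<open>e\<close> and \<open>e'\<close> are the targets for the current and the
    next gap; \<open>p\<close> is the exponent of the squared gradient inequality.\<close>
  define e e' p where "e = \<Delta> * exp (- \<gamma> * real k)" and "e' = \<Delta> * exp (- \<gamma> * real (Suc k))"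
    and "p = 2 * \<theta>"
  have e: "e > 0" "e' > 0" and p: "p \<ge> 1" using \<Delta> \<theta> by (simp_all add: e_def e'_def p_def)
  \<comment> \<open>This is \<open>c\<^sup>2\<close> times the slope of \<open>u powr p\<close> at
    \<open>e'\<close>, the normalization of \<open>powr_ge_tangent\<close>.\<close>
  define w where "w = c\<^sup>2 * (p * e' powr (p - 1))"
  have w: "w > 0" using c e p by (simp add: w_def)
  have xm [measurable]: "(\<lambda>\<omega>. env (x j \<omega>)) \<in> borel_measurable M"
      "(\<lambda>\<omega>. grad (x j \<omega>)) \<in> borel_measurable M" if "j \<le> N" for j
    using x_measurable_M[OF that] by (auto intro: measurable_compose)

  \<comment> \<open>Jensen for the square root, through its tangent at \<open>e\<close>, where the
    induction hypothesis makes the bound equal to \<open>sqrt e\<close>.\<close>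
  have "(\<integral>\<^sup>+\<omega>. ennreal (sqrt (env (x k \<omega>) - m)) \<partial>M)
      \<le> (\<integral>\<^sup>+\<omega>. ennreal (1 / (2 * sqrt e)) * ennreal (env (x k \<omega>) - m) + ennreal (sqrt e / 2) \<partial>M)"
  proof (rule nn_integral_mono)
    fix \<omega>
    let ?u = "env (x k \<omega>) - m"
    have u: "0 \<le> ?u" using env_ge by simp
    have "0 \<le> (sqrt ?u - sqrt e)\<^sup>2" by simp
    also have "\<dots> = ?u + e - 2 * sqrt ?u * sqrt e"
      using u e by (simp add: power2_diff)
    finally have "2 * sqrt ?u * sqrt e \<le> ?u + (sqrt e)\<^sup>2"
      using e by simp
    then have "sqrt ?u \<le> 1 / (2 * sqrt e) * ?u + sqrt e / 2"
      using e by (simp add: field_simps power2_eq_square)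
    then have "ennreal (sqrt ?u) \<le> ennreal (1 / (2 * sqrt e) * ?u + sqrt e / 2)"
      by (rule ennreal_leI)
    then show "ennreal (sqrt ?u) \<le> ennreal (1 / (2 * sqrt e)) * ennreal ?u + ennreal (sqrt e / 2)"
      using u e by (simp add: ennreal_mult[symmetric] ennreal_plus[symmetric] del: ennreal_plus)
  qed
  also have "\<dots> = ennreal (1 / (2 * sqrt e)) * (\<integral>\<^sup>+\<omega>. ennreal (env (x k \<omega>) - m) \<partial>M) + ennreal (sqrt e / 2)"
    using xm[of k] k by (simp add: nn_integral_add nn_integral_cmult emeasure_space_1)
  also have "\<dots> \<le> ennreal (1 / (2 * sqrt e)) * ennreal e + ennreal (sqrt e / 2)"
    using Suc by (intro add_right_mono mult_left_mono) (auto simp: e_def)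
  also have "\<dots> = ennreal (1 / (2 * sqrt e) * e + sqrt e / 2)"
    using e by (simp add: ennreal_mult[symmetric] ennreal_plus[symmetric] del: ennreal_plus)
  also have "1 / (2 * sqrt e) * e + sqrt e / 2 = sqrt e"
    using e by (simp add: real_div_sqrt field_simps)
  finally have sqrt_le: "(\<integral>\<^sup>+\<omega>. ennreal (sqrt (env (x k \<omega>) - m)) \<partial>M) \<le> ennreal (sqrt e)" .

  \<comment> \<open>The prescribed \<open>t k\<close> is exactly what makes this square equal to
    \<open>(c\<^sup>2 * e' powr p)\<^sup>2 * real (t k)\<close>; replacing \<open>t k\<close> by
    \<open>t k + 1\<close> only helps.\<close>
  have "(4 * sqrt \<rho> * L * sqrt e)\<^sup>2 = 16 * \<rho> * L\<^sup>2 * e"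
    using rho_pos e by (simp add: power_mult_distrib)
  also have "\<dots> = (c\<^sup>2 * e' powr p)\<^sup>2 * real (t k)"
  proof -
    have "(e' powr p)\<^sup>2 = e' powr (4 * \<theta>)"
      using e by (simp add: p_def powr_powr flip: powr_numeral)
    also have "\<dots> = \<Delta> powr (4 * \<theta>) * exp (- \<gamma> * real (Suc k) * (4 * \<theta>))"
      unfolding e'_def using \<Delta> by (simp add: powr_mult exp_powr_real)
    finally have "(c\<^sup>2 * e' powr p)\<^sup>2 * real (t k)
        = (c ^ 4 * c powi (-4)) * 16 * \<rho> * L\<^sup>2 * (\<Delta> powr (4 * \<theta>) * \<Delta> powr (1 - 4 * \<theta>))
          * (exp (- \<gamma> * real (Suc k) * (4 * \<theta>)) * exp (4 * \<theta> * \<gamma>) * exp ((4 * \<theta> - 1) * \<gamma> * real k))"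
      unfolding t[OF k] by (simp add: power_mult_distrib mult_ac)
    also have "c ^ 4 * c powi (-4) = 1" using c by (simp add: power_int_minus)
    also have "\<Delta> powr (4 * \<theta>) * \<Delta> powr (1 - 4 * \<theta>) = \<Delta>" using \<Delta> by (simp flip: powr_add)
    also have "exp (- \<gamma> * real (Suc k) * (4 * \<theta>)) * exp (4 * \<theta> * \<gamma>) * exp ((4 * \<theta> - 1) * \<gamma> * real k)
        = exp (- \<gamma> * real k)"
      by (simp add: algebra_simps flip: exp_add)
    finally show ?thesis by (simp add: e_def)
  qed
  also have "\<dots> \<le> (c\<^sup>2 * e' powr p * sqrt (real (t k) + 1))\<^sup>2"
    by (simp add: power_mult_distrib mult_left_mono)
  finally have "4 * sqrt \<rho> * L * sqrt e \<le> c\<^sup>2 * e' powr p * sqrt (real (t k) + 1)"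
    by (rule power2_le_imp_le) simp
  then have "4 * sqrt \<rho> * L / sqrt (real (t k) + 1) * sqrt e \<le> c\<^sup>2 * e' powr p"
    by (simp add: field_simps)
  also have "\<dots> = w * (e' / p)"
    using e p by (simp add: w_def powr_diff)
  finally have bound: "4 * sqrt \<rho> * L / sqrt (real (t k) + 1) * sqrt e \<le> w * (e' / p)" .

  have "(\<integral>\<^sup>+\<omega>. ennreal ((norm (grad (x (Suc k) \<omega>)))\<^sup>2) \<partial>M)
      \<le> ennreal (4 * sqrt \<rho> * L / sqrt (real (t k) + 1)) * ennreal (sqrt e)"
    using sqrt_le by (intro order_trans[OF expected_gradient_le[OF k]] mult_left_mono) auto
  also have "\<dots> \<le> ennreal (w * (e' / p))"
    using rho_pos L_pos e bound by (subst ennreal_mult[symmetric]) (auto intro: ennreal_leI)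
  finally have grad_le: "(\<integral>\<^sup>+\<omega>. ennreal ((norm (grad (x (Suc k) \<omega>)))\<^sup>2) \<partial>M) \<le> ennreal (w * (e' / p))" .

  \<comment> \<open>The finite constant \<open>e' / p\<close> is carried on the left to avoid
    subtraction. The gradient bound produces the same constant on the right, and the two
    cancel.\<close>
  have "(\<integral>\<^sup>+\<omega>. ennreal (env (x (Suc k) \<omega>) - m) \<partial>M) + ennreal (e' / p)
      = (\<integral>\<^sup>+\<omega>. ennreal (env (x (Suc k) \<omega>) - m) + ennreal (e' / p) \<partial>M)"
    using xm[of "Suc k"] k by (simp add: nn_integral_add emeasure_space_1)
  also have "\<dots> \<le> (\<integral>\<^sup>+\<omega>. ennreal e' + ennreal (1 / w) * ennreal ((norm (grad (x (Suc k) \<omega>)))\<^sup>2) \<partial>M)"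
    using KL
  proof (intro nn_integral_mono_AE, eventually_elim)
    fix \<omega> assume *: "\<forall>k\<le>N. c * (env (x k \<omega>) - m) powr \<theta> \<le> norm (grad (x k \<omega>))"
    let ?u = "env (x (Suc k) \<omega>) - m" and ?n = "norm (grad (x (Suc k) \<omega>))"
    have u: "0 \<le> ?u" using env_ge by simp
    have "c\<^sup>2 * ?u powr p = (c * ?u powr \<theta>)\<^sup>2"
      by (cases "?u = 0") (use u in \<open>simp_all add: p_def power_mult_distrib powr_power mult.commute\<close>)
    also have "\<dots> \<le> ?n\<^sup>2" using * k c u by (intro power_mono) auto
    finally have "c\<^sup>2 * ?u powr p / w \<le> ?n\<^sup>2 / w" using w by (simp add: divide_right_mono)
    moreover have "c\<^sup>2 * ?u powr p / w = ?u powr p / (p * e' powr (p - 1))"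
      using c by (simp add: w_def)
    ultimately have "?u + e' / p \<le> e' + 1 / w * ?n\<^sup>2"
      using powr_ge_tangent[OF u e(2) p] by simp
    then have "ennreal (?u + e' / p) \<le> ennreal (e' + 1 / w * ?n\<^sup>2)" by (rule ennreal_leI)
    then show "ennreal ?u + ennreal (e' / p) \<le> ennreal e' + ennreal (1 / w) * ennreal (?n\<^sup>2)"
      using u e p w by (simp add: ennreal_mult[symmetric] ennreal_plus[symmetric] del: ennreal_plus)
  qed
  also have "\<dots> = ennreal e' + ennreal (1 / w) * (\<integral>\<^sup>+\<omega>. ennreal ((norm (grad (x (Suc k) \<omega>)))\<^sup>2) \<partial>M)"
    using xm[of "Suc k"] k by (simp add: nn_integral_add nn_integral_cmult emeasure_space_1)
  also have "\<dots> \<le> ennreal e' + ennreal (1 / w) * ennreal (w * (e' / p))"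
    by (intro add_left_mono mult_left_mono grad_le) auto
  also have "\<dots> = ennreal e' + ennreal (e' / p)"
    using w e p by (simp add: ennreal_mult[symmetric])
  finally have "(\<integral>\<^sup>+\<omega>. ennreal (env (x (Suc k) \<omega>) - m) \<partial>M) \<le> ennreal e'"
    by (simp add: add.commute[of _ "ennreal (e' / p)"] ennreal_add_left_cancel_le)
  then show ?case unfolding e'_def .
qed

end

section \<open>From outer iterations to the total iteration count\<close>

lemma geometric_sum_bound:
  fixes b :: real
  assumes "b \<ge> 0"
  shows "b * (\<Sum>k<n. exp (b * real k)) + 1 \<le> exp (b * real n)"
proof -
  have pow: "exp (b * real k) = exp b ^ k" for k
    using exp_of_nat_mult[of k b] by (simp add: mult.commute)
  \<comment> \<open>This replaces \<open>b\<close> by the factor that telescopes the geometric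
    sum.\<close>
  have "b \<le> exp b - 1" using exp_ge_add_one_self[of b] by linarith
  then have "b * (\<Sum>k<n. exp b ^ k) \<le> (exp b - 1) * (\<Sum>k<n. exp b ^ k)"
    by (intro mult_right_mono sum_nonneg) auto
  also have "\<dots> = exp b ^ n - 1" by (simp add: power_diff_1_eq)
  finally show ?thesis by (simp add: pow)
qed

theorem theorem3p4:
  fixes g :: "'a::euclidean_space \<Rightarrow> real"
    and f :: "'a \<Rightarrow> ereal"
    and X V :: "'a set"
    and \<rho> c \<theta> \<gamma> L fstar \<Delta>\<^sub>0 C T :: real
    and \<phi> :: "'a \<Rightarrow> real"
    and D :: "'b measure"
    and G :: "'a \<Rightarrow> 'b \<Rightarrow> 'a"
    and M :: "'w measure"
    and \<xi> :: "nat \<Rightarrow> nat \<Rightarrow> 'w \<Rightarrow> 'b"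
    and S :: "nat \<Rightarrow> 'w \<Rightarrow> nat"
    and N :: nat
    and t :: "nat \<Rightarrow> nat"
    and \<alpha> :: "nat \<Rightarrow> 'w \<Rightarrow> real"
    and x\<^sub>0 :: 'a
    and x :: "nat \<Rightarrow> 'w \<Rightarrow> 'a"
  assumes rho: "\<rho> > 0"
    and g: "weakly_convex \<rho> g"
    and X: "closed X" "convex X" "X \<noteq> {}"
    and f: "f = (\<lambda>y. ereal (g y) + convex_indicator X y)"
    and fstar: "(INF y. f y) = ereal fstar"
    and phi: "\<phi> = (\<lambda>y. real_of_ereal (moreau_envelope (1 / (2 * \<rho>)) f y))"
    and c: "c > 0"
    and theta: "1 / 2 \<le> \<theta>" "\<theta> \<le> 1"
    and KL: "\<And>y. y \<in> V \<Longrightarrow> norm (gradient \<phi> y) \<ge> c * (\<phi> y - fstar) powr \<theta>"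
    and L: "L > 0"
    and G: "stochastic_oracle g X L D G"
    and x0: "x\<^sub>0 \<in> X" "x\<^sub>0 \<in> V"
    and Delta0: "\<Delta>\<^sub>0 = \<phi> x\<^sub>0 - fstar" "\<Delta>\<^sub>0 > 0"
    and gamma: "\<gamma> > 0"
    and inputs: "independent_restart_inputs M D N t \<xi> S"
    and t: "\<And>k. k < N \<Longrightarrow>
          real (t k) = 16 * c powi (-4) * \<rho> * L\<^sup>2 * \<Delta>\<^sub>0 powr (1 - 4 * \<theta>) * exp (4 * \<theta> * \<gamma>)
                        * exp ((4 * \<theta> - 1) * \<gamma> * real k)"
    and alpha: "\<And>k \<omega>. k < N \<Longrightarrow> \<omega> \<in> space M \<Longrightarrow>
          \<alpha> k \<omega> = sqrt (\<phi> (x k \<omega>) - fstar) / (sqrt \<rho> * L * sqrt (real (t k) + 1))"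
    and x_0: "\<And>\<omega>. \<omega> \<in> space M \<Longrightarrow> x 0 \<omega> = x\<^sub>0"
    and x_Suc: "\<And>k \<omega>. k < N \<Longrightarrow> \<omega> \<in> space M \<Longrightarrow>
          x (Suc k) \<omega> = psgm_iterate X G (\<alpha> k \<omega>) (x k \<omega>) (\<lambda>s. \<xi> k s \<omega>) (S k \<omega>)"
    and V: "AE \<omega> in M. \<forall>k\<le>N. x k \<omega> \<in> V"
    and T: "T = (\<Sum>k<N. real (t k))"
    and C: "C = 16 * c powi (-4) * \<rho> * L\<^sup>2 * \<Delta>\<^sub>0 powr (1 - 4 * \<theta>) * exp (4 * \<theta> * \<gamma>)"
  shows "integrable M (\<lambda>\<omega>. \<phi> (x N \<omega>)) \<and>
         (\<integral>\<omega>. \<phi> (x N \<omega>) \<partial>M) - fstar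
           \<le> (\<phi> x\<^sub>0 - fstar) / (\<gamma> * (4 * \<theta> - 1) * inverse C * T + 1) powr (1 / (4 * \<theta> - 1))"
proof -
  have prob: "prob_space M" using inputs by (simp add: independent_restart_inputs_def)
  have lower: "fstar \<le> g y" if "y \<in> X" for y
  proof -
    have "ereal fstar \<le> f y" unfolding fstar[symmetric] by (rule INF_lower) simp
    then show ?thesis using that by (simp add: f convex_indicator_def)
  qed
  \<comment> \<open>The lower bound \<open>m\<close> becomes the infimum of \<open>f\<close>, which
    is a lower bound of \<open>g\<close> on \<open>X\<close> because the indicator vanishes
    there.\<close>
  interpret weakly_convex_on_set g X \<rho> fstar
    by standard (use rho g X lower in auto)
  have phi_eq: "\<phi> = env"
    unfolding phi f moreau_envelope_eq by simp
  interpret restarted_subgradient_method g X \<rho> fstar L D G M N t \<xi> S \<alpha> x x\<^sub>0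
    by (intro restarted_subgradient_method.intro subgradient_method.intro
        weakly_convex_on_set_axioms subgradient_method_axioms.intro
        restarted_subgradient_method_axioms.intro prob)
      (use L G inputs x0 x_0 x_Suc alpha in \<open>auto simp: phi_eq\<close>)
  have gradient_env: "gradient env y = grad y" for y
    by (rule gradient_eq[OF gderiv_env])
  have KL': "AE \<omega> in M. \<forall>k\<le>N. c * (env (x k \<omega>) - fstar) powr \<theta> \<le> norm (grad (x k \<omega>))"
    using V by eventually_elim (use KL in \<open>simp add: gradient_env phi_eq\<close>)
  have nn: "(\<integral>\<^sup>+\<omega>. ennreal (\<phi> (x N \<omega>) - fstar) \<partial>M) \<le> ennreal (\<Delta>\<^sub>0 * exp (- \<gamma> * real N))"
    using expected_gap_le[OF c theta(1) KL' Delta0[unfolded phi_eq] t order_refl]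
    by (simp add: phi_eq)
  have nonneg: "0 \<le> \<phi> (x N \<omega>) - fstar" for \<omega>
    using env_ge by (simp add: phi_eq)
  have meas: "(\<lambda>\<omega>. \<phi> (x N \<omega>) - fstar) \<in> borel_measurable M"
    unfolding phi_eq using measurable_compose[OF x_measurable_M[OF order_refl] measurable_env] by simp
  \<comment> \<open>Integrability comes out of the finite extended integral.\<close>
  have int: "integrable M (\<lambda>\<omega>. \<phi> (x N \<omega>) - fstar)"
    using nn nonneg by (intro integrableI_nonneg meas) (auto intro: le_less_trans)
  then have int': "integrable M (\<lambda>\<omega>. \<phi> (x N \<omega>))"
    using Bochner_Integration.integrable_add[OF int integrable_const[of fstar]] by simp
  have "ennreal (\<integral>\<omega>. \<phi> (x N \<omega>) - fstar \<partial>M) \<le> ennreal (\<Delta>\<^sub>0 * exp (- \<gamma> * real N))"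
    using nn int nonneg by (subst nn_integral_eq_integral[symmetric]) auto
  then have "(\<integral>\<omega>. \<phi> (x N \<omega>) - fstar \<partial>M) \<le> \<Delta>\<^sub>0 * exp (- \<gamma> * real N)"
    using Delta0 by (subst (asm) ennreal_le_iff) auto
  then have gap: "(\<integral>\<omega>. \<phi> (x N \<omega>) \<partial>M) - fstar \<le> \<Delta>\<^sub>0 * exp (- \<gamma> * real N)"
    using int' by (simp add: prob_space)
  define b where "b = (4 * \<theta> - 1) * \<gamma>"
  have b: "b > 0" using theta gamma by (simp add: b_def)
  have "C > 0" unfolding C using c rho L Delta0 by simp
  moreover have "T = C * (\<Sum>k<N. exp (b * real k))"
    unfolding T sum_distrib_left by (intro sum.cong) (simp_all add: t C b_def)
  ultimately have CT: "\<gamma> * (4 * \<theta> - 1) * inverse C * T = b * (\<Sum>k<N. exp (b * real k))"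
    by (simp add: b_def)
  let ?B = "\<gamma> * (4 * \<theta> - 1) * inverse C * T + 1"
  have B: "1 \<le> ?B" "?B \<le> exp (b * real N)"
    unfolding CT using b geometric_sum_bound[of b N] by (auto intro!: mult_nonneg_nonneg sum_nonneg)
  \<comment> \<open>The exponent is positive as \<theta> is at least 1/2, and it turns exp(bN) into
    exp(\<gamma>N), the decay factor of the gap.\<close>
  have "?B powr (1 / (4 * \<theta> - 1)) \<le> exp (b * real N) powr (1 / (4 * \<theta> - 1))"
    using B theta by (intro powr_mono2) auto
  also have "\<dots> = exp (\<gamma> * real N)"
    using theta by (simp add: exp_powr_real b_def)
  finally have "\<Delta>\<^sub>0 / exp (\<gamma> * real N) \<le> \<Delta>\<^sub>0 / ?B powr (1 / (4 * \<theta> - 1))"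
    using Delta0(2) B by (intro divide_left_mono) auto
  with gap have "(\<integral>\<omega>. \<phi> (x N \<omega>) \<partial>M) - fstar \<le> \<Delta>\<^sub>0 / ?B powr (1 / (4 * \<theta> - 1))"
    by (simp add: exp_minus divide_inverse)
  with int' show ?thesis unfolding Delta0(1) by simp
qed

end
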